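(* Let $s\ge3$. If $d\in\Delta^\times$ has level $n=p^{r+1}+pm-1$ of type $1$ (so $m\ge1$ and $m\not\equiv0\bmod p$), then $$d\equiv[u,1-\Pi^{pm}x]\pmod{\Pi^{n+1}\Delta}\quad\text{for some }x\in\Delta.$$
   Context: Let $p$ be an odd prime, $r\ge1$, $s\ge1$ integers, $F/\mathbb Q_p$ a finite unramified extension with ring of integers $\mathfrak O$. Fix primitive $p^m$-th roots of unity $\zeta_m$ with $\zeta_0=1$, $\zeta_m^p=\zeta_{m-1}$; put $\mathfrak O_m=\mathfrak O[\zeta_m]$, $\pi_m=1-\zeta_m$, $\Pi=\pi_{r+s}$, $\pi=\pi_r$, $A=\mathfrak O_r[[T]]$, $B=\mathfrak O_{r+s}[[T]]$, with fraction fields $\mathfrak q(A),\mathfrak q(B)$. Let $g$ be the generator of the cyclic group $\mathrm{Gal}(\mathfrak q(B)/\mathfrak q(A))$ (of order $p^s$) fixing $\mathfrak q(A)$ with $\zeta_{r+s}\mapsto\zeta_{r+s}^{1+p^r}$. $D=\bigoplus_{j=0}^{p^s-1}\mathfrak q(B)u^j$ with $ub={}^gb\,u$ and $u^{p^s}=1+T$ is a division algebra with centre $\mathfrak q(A)$, and $\Delta=\bigoplus_{j=0}^{p^s-1}Bu^j$ is an $A$-order in $D$ with $\Pi\Delta=\Delta\Pi$. The level of $d\in1+\Pi\Delta$ is $\max\{k\ge1:d\in1+\Pi^k\Delta\}$ (having level $n$ includes $d\in 1+\Pi\Delta$). The integer $n\ge1$ has type $t\ge0$ if $n=p^{r+t}+p^tm-1$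 for some $m\ge1$ with $m\not\equiv0\bmod p$. $[x,y]=xyx^{-1}y^{-1}$; elements of $1+\Pi\Delta$ are units of $\Delta$. *)

theory Defs
  imports "HOL-Computational_Algebra.Computational_Algebra" "HOL-Algebra.Coset" "HOL-Algebra.Ring"
begin

text \<open>
  \<open>\<rat>\<^sub>p\<close>, \<open>F\<close> and the roots of unity all live inside one ambient field \<open>'k\<close>; \<open>nrm\<close> is the absolute
  value of \<open>F\<close> and is left unspecified outside \<open>F\<close>.
\<close>

definition is_subfield :: "'a::field set \<Rightarrow> bool" where
  "is_subfield K \<longleftrightarrow> 0 \<in> K \<and> 1 \<in> K \<and>
     (\<forall>x\<in>K. \<forall>y\<in>K. x - y \<in> K \<and> x * y \<in> K) \<and> (\<forall>x\<in>K. inverse x \<in> K)"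

definition nonarch_abs_on :: "('a::field \<Rightarrow> real) \<Rightarrow> 'a set \<Rightarrow> bool" where
  "nonarch_abs_on nrm K \<longleftrightarrow>
     (\<forall>x\<in>K. 0 \<le> nrm x \<and> (nrm x = 0 \<longleftrightarrow> x = 0)) \<and>
     (\<forall>x\<in>K. \<forall>y\<in>K. nrm (x * y) = nrm x * nrm y \<and> nrm (x + y) \<le> max (nrm x) (nrm y))"

definition padic_abs :: "nat \<Rightarrow> rat \<Rightarrow> real" where
  "padic_abs p q = (if q = 0 then 0 else
     (let (a, b) = quotient_of q in
        real p powi (int (multiplicity (int p) b) - int (multiplicity (int p) a))))"

text \<open>
  \<open>\<rat>\<^sub>p\<close> as the completion of \<open>\<rat>\<close>: a field with an absolute value extending the \<open>p\<close>-adic one,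
  in which \<open>\<rat>\<close> is dense and every Cauchy sequence converges.
\<close>

definition is_padic_field :: "nat \<Rightarrow> ('a::field_char_0 \<Rightarrow> real) \<Rightarrow> 'a set \<Rightarrow> bool" where
  "is_padic_field p nrm Qp \<longleftrightarrow>
     is_subfield Qp \<and> nonarch_abs_on nrm Qp \<and>
     (\<forall>q. nrm (of_rat q) = padic_abs p q) \<and>
     (\<forall>x\<in>Qp. \<forall>e>0. \<exists>q. nrm (x - of_rat q) < e) \<and>
     (\<forall>X :: nat \<Rightarrow> 'a. (\<forall>i. X i \<in> Qp) \<longrightarrow>
        (\<forall>e>0. \<exists>M. \<forall>i\<ge>M. \<forall>j\<ge>M. nrm (X i - X j) < e) \<longrightarrow>
        (\<exists>l\<in>Qp. (\<lambda>i. nrm (X i - l)) \<longlonglongrightarrow> 0))"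

definition finite_extension :: "'a::field set \<Rightarrow> 'a set \<Rightarrow> bool" where
  "finite_extension K L \<longleftrightarrow> is_subfield K \<and> is_subfield L \<and> K \<subseteq> L \<and>
     (\<exists>X. finite X \<and> X \<subseteq> L \<and> (\<forall>y\<in>L. \<exists>c. (\<forall>x\<in>X. c x \<in> K) \<and> y = (\<Sum>x\<in>X. c x * x)))"

text \<open>
  Unramified means ramification index 1, i.e. equal value groups; separability of the residue
  field extension is automatic over \<open>\<rat>\<^sub>p\<close>, whose residue field is finite.
\<close>

definition finite_unramified_extension ::
    "('a::field \<Rightarrow> real) \<Rightarrow> 'a set \<Rightarrow> 'a set \<Rightarrow> bool" where
  "finite_unramified_extension nrm K L \<longleftrightarrow>
     finite_extension K L \<and> nonarch_abs_on nrm L \<and> nrm ` (L - {0}) = nrm ` (K - {0})"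

definition ring_of_integers :: "('a::field \<Rightarrow> real) \<Rightarrow> 'a set \<Rightarrow> 'a set" where
  "ring_of_integers nrm K = {x \<in> K. nrm x \<le> 1}"

definition adjoin :: "'a::comm_ring_1 set \<Rightarrow> 'a \<Rightarrow> 'a set" where
  "adjoin R z = {poly q z | q. \<forall>i. coeff q i \<in> R}"

definition primitive_root_of_unity :: "nat \<Rightarrow> 'a::field \<Rightarrow> bool" where
  "primitive_root_of_unity N z \<longleftrightarrow> z ^ N = 1 \<and> (\<forall>k. 0 < k \<and> k < N \<longrightarrow> z ^ k \<noteq> 1)"

text \<open>
  \<open>R[[T]]\<close> is realised inside the field of Laurent series \<open>'k((T))\<close> (the fraction field of
  \<open>'k[[T]]\<close>), so that the fraction field of \<open>R[[T]]\<close> is the set of quotients there.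
\<close>

definition power_series_ring :: "'a::field set \<Rightarrow> 'a fls set" where
  "power_series_ring R = fps_to_fls ` {f. \<forall>i. fps_nth f i \<in> R}"

definition fraction_field :: "'a::field set \<Rightarrow> 'a set" where
  "fraction_field R = {a / b | a b. a \<in> R \<and> b \<in> R \<and> b \<noteq> 0}"

text \<open>Automorphisms of \<open>L\<close> over \<open>K\<close>; their values outside \<open>L\<close> are irrelevant.\<close>

definition galois_group :: "'a::field set \<Rightarrow> 'a set \<Rightarrow> ('a \<Rightarrow> 'a) set" where
  "galois_group L K = {g. bij_betw g L L \<and>
     (\<forall>x\<in>L. \<forall>y\<in>L. g (x + y) = g x + g y \<and> g (x * y) = g x * g y) \<and> (\<forall>x\<in>K. g x = x)}"

text \<open>
  The cyclic algebra \<open>\<Oplus>\<^bsub>j<N\<^esub> L u\<^sup>j\<close> with \<open>u b = g(b) u\<close> and \<open>u\<^sup>N = c\<close>: the function \<open>x\<close> stands for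
  the sum of the \<open>x j u\<^sup>j\<close>, and \<open>(a u\<^sup>i) (b u\<^sup>j) = a g\<^sup>i(b) u\<^sup>i\<^sup>+\<^sup>j\<close>, where \<open>u\<^sup>k\<^sup>+\<^sup>N = c u\<^sup>k\<close>
  (\<open>c\<close> is fixed by \<open>g\<close>, hence central).
\<close>

definition cyclic_algebra ::
    "nat \<Rightarrow> ('a::field \<Rightarrow> 'a) \<Rightarrow> 'a \<Rightarrow> 'a set \<Rightarrow> (nat \<Rightarrow> 'a) ring" where
  "cyclic_algebra N g c L =
     \<lparr>carrier = {x. (\<forall>j<N. x j \<in> L) \<and> (\<forall>j\<ge>N. x j = 0)},
      mult = (\<lambda>x y k. if k < N
                then (\<Sum>i<N. \<Sum>j<N. if i + j = k then x i * (g ^^ i) (y j)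
                                   else if i + j = k + N then x i * (g ^^ i) (y j) * c
                                   else 0)
                else 0),
      one = (\<lambda>k. if k = 0 then 1 else 0),
      zero = (\<lambda>k. 0),
      add = (\<lambda>x y k. x k + y k)\<rparr>"

definition scalar :: "'a::zero \<Rightarrow> nat \<Rightarrow> 'a" where
  "scalar b = (\<lambda>k. if k = 0 then b else 0)"

definition u_gen :: "nat \<Rightarrow> 'a::zero_neq_one" where
  "u_gen = (\<lambda>k. if k = 1 then 1 else 0)"

definition \<OO> :: "('k::field \<Rightarrow> real) \<Rightarrow> 'k set \<Rightarrow> (nat \<Rightarrow> 'k) \<Rightarrow> nat \<Rightarrow> 'k set" where
  "\<OO> nrm F \<zeta> m = adjoin (ring_of_integers nrm F) (\<zeta> m)"

definition A_ring :: "nat \<Rightarrow> ('k::field \<Rightarrow> real) \<Rightarrow> 'k set \<Rightarrow> (nat \<Rightarrow> 'k) \<Rightarrow> 'k fls set" where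
  "A_ring r nrm F \<zeta> = power_series_ring (\<OO> nrm F \<zeta> r)"

definition B_ring :: "nat \<Rightarrow> nat \<Rightarrow> ('k::field \<Rightarrow> real) \<Rightarrow> 'k set \<Rightarrow> (nat \<Rightarrow> 'k) \<Rightarrow> 'k fls set" where
  "B_ring r s nrm F \<zeta> = power_series_ring (\<OO> nrm F \<zeta> (r + s))"

definition D_alg :: "nat \<Rightarrow> nat \<Rightarrow> nat \<Rightarrow> ('k::field \<Rightarrow> real) \<Rightarrow> 'k set \<Rightarrow> (nat \<Rightarrow> 'k) \<Rightarrow>
    ('k fls \<Rightarrow> 'k fls) \<Rightarrow> (nat \<Rightarrow> 'k fls) ring" where
  "D_alg p r s nrm F \<zeta> g =
     cyclic_algebra (p ^ s) g (1 + fls_X) (fraction_field (B_ring r s nrm F \<zeta>))"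

definition \<Delta> :: "nat \<Rightarrow> nat \<Rightarrow> nat \<Rightarrow> ('k::field \<Rightarrow> real) \<Rightarrow> 'k set \<Rightarrow> (nat \<Rightarrow> 'k) \<Rightarrow>
    ('k fls \<Rightarrow> 'k fls) \<Rightarrow> (nat \<Rightarrow> 'k fls) ring" where
  "\<Delta> p r s nrm F \<zeta> g = (D_alg p r s nrm F \<zeta> g)
     \<lparr>carrier := {x \<in> carrier (D_alg p r s nrm F \<zeta> g). \<forall>j<p ^ s. x j \<in> B_ring r s nrm F \<zeta>}\<rparr>"

definition Pi_B :: "nat \<Rightarrow> nat \<Rightarrow> (nat \<Rightarrow> 'k::field) \<Rightarrow> nat \<Rightarrow> 'k fls" where
  "Pi_B r s \<zeta> = scalar (fls_const (1 - \<zeta> (r + s)))"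

definition commutator :: "('a, 'b) monoid_scheme \<Rightarrow> 'a \<Rightarrow> 'a \<Rightarrow> 'a" where
  "commutator G x y = x \<otimes>\<^bsub>G\<^esub> y \<otimes>\<^bsub>G\<^esub> inv\<^bsub>G\<^esub> x \<otimes>\<^bsub>G\<^esub> inv\<^bsub>G\<^esub> y"

definition cong_mod_pow :: "('a, 'b) ring_scheme \<Rightarrow> 'a \<Rightarrow> nat \<Rightarrow> 'a \<Rightarrow> 'a \<Rightarrow> bool" where
  "cong_mod_pow R P k x y \<longleftrightarrow> x \<ominus>\<^bsub>R\<^esub> y \<in> (P [^]\<^bsub>R\<^esub> k) <#\<^bsub>R\<^esub> carrier R"

text \<open>\<open>n = max {k \<ge> 1. d \<in> 1 + P\<^sup>k R}\<close>, including that the maximum exists.\<close>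

definition has_level :: "('a, 'b) ring_scheme \<Rightarrow> 'a \<Rightarrow> 'a \<Rightarrow> nat \<Rightarrow> bool" where
  "has_level R P d n \<longleftrightarrow> 1 \<le> n \<and> cong_mod_pow R P n d \<one>\<^bsub>R\<^esub> \<and>
     (\<forall>k\<ge>1. cong_mod_pow R P k d \<one>\<^bsub>R\<^esub> \<longrightarrow> k \<le> n)"

text \<open>\<open>n\<close> has type \<open>t\<close>, with \<open>m\<close> the witness.\<close>

definition has_type :: "nat \<Rightarrow> nat \<Rightarrow> nat \<Rightarrow> nat \<Rightarrow> nat \<Rightarrow> bool" where
  "has_type p r n t m \<longleftrightarrow> 1 \<le> m \<and> \<not> p dvd m \<and> n = p ^ (r + t) + p ^ t * m - 1"

end

theory Submission
  imports Defs
begin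

text \<open>
  Write \<open>\<Pi> = 1 - \<zeta>\<^sub>r\<^sub>+\<^sub>s\<close> and \<open>w\<close> for an element of \<open>\<Delta>\<close> with coefficients in \<open>\<OO>[[T]]\<close>; such \<open>w\<close> commute with \<open>u\<close>
  and represent all residue classes of \<open>\<Delta>\<close> modulo \<open>\<Pi>\<close>. For \<open>y\<close> in \<open>B\<close> divisible by \<open>\<Pi>\<close>,
  \<open>[u, 1 - y w] = (1 - g(y) w) (1 - y w)\<^bsup>-1\<^esup>\<close>, which is \<open>1 + (y - g(y)) w\<close> to leading order. So it suffices to
  find \<open>y\<close> divisible by \<open>\<Pi>\<^bsup>pm\<^esup>\<close> with \<open>y - g(y) \<equiv> \<Pi>\<^sup>n\<close> modulo \<open>\<Pi>\<^bsup>n+1\<^esup>\<close>.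

  Put \<open>\<pi>\<^sub>k = 1 - \<zeta>\<^bsup>p^k\<^esup>\<close> with \<open>\<zeta> = \<zeta>\<^sub>r\<^sub>+\<^sub>s\<close> (so the index runs opposite to the usual \<open>\<pi>\<^sub>m = 1 - \<zeta>\<^sub>m\<close>); it is \<open>\<Pi>\<close> to the power \<open>p\<^sup>k\<close> to leading order. Modulo \<open>\<Pi>\<^bsup>n+1\<^esup>\<close>,
  \<open>\<Pi>\<^sup>n\<close> is \<open>\<pi>\<^sub>1\<^bsup>m-1\<^esup> \<pi>\<^bsub>r+1\<^esub> (1 - \<zeta>)\<^bsup>p-1\<^esup>\<close>. Expand \<open>(1 - \<zeta>)\<^bsup>p-1\<^esup>\<close> in powers of \<open>\<zeta>\<close>: each term \<open>\<zeta>\<^sup>i\<close> with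
  \<open>0 < i < p\<close> is reached because \<open>g(\<zeta>\<^sup>i) = \<zeta>\<^sup>i \<zeta>\<^bsup>i p^r\<^esup>\<close> and \<open>1 - \<zeta>\<^bsup>i p^r\<^esup>\<close> is an associate of \<open>\<pi>\<^sub>r\<close>, a divisor of
  \<open>\<pi>\<^bsub>r+1\<^esub>\<close>; the constant term is reached because \<open>g(\<pi>\<^sub>1\<^sup>m) - \<pi>\<^sub>1\<^sup>m\<close> is \<open>m \<pi>\<^sub>1\<^bsup>m-1\<^esup> \<pi>\<^bsub>r+1\<^esub>\<close> to leading order and
  \<open>m\<close> is prime to \<open>p\<close>.

  Completeness of \<open>\<OO>\<close> is not needed for \<open>1 - \<Pi> z\<close> to be a unit of \<open>\<Delta>\<close>: a power of \<open>\<Pi>\<close> is divisible by \<open>p\<close>,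
  \<open>p\<close> lies in the Jacobson radical of \<open>\<OO>[[T]]\<close>, and \<open>\<Delta>\<close> is a finitely generated \<open>\<OO>[[T]]\<close>-module, so
  Nakayama's lemma applies to the left ideal generated by \<open>1 - p z\<close>.
\<close>

section \<open>Subrings of a field\<close>

locale subring_set =
  fixes S :: "'a::field set"
  assumes one_mem: "1 \<in> S"
    and diff_mem: "x \<in> S \<Longrightarrow> y \<in> S \<Longrightarrow> x - y \<in> S"
    and mult_mem: "x \<in> S \<Longrightarrow> y \<in> S \<Longrightarrow> x * y \<in> S"
begin

lemma zero_mem: "0 \<in> S"
  using diff_mem[OF one_mem one_mem] by simp

lemma uminus_mem: "x \<in> S \<Longrightarrow> - x \<in> S"
  using diff_mem[OF zero_mem] by simp

lemma add_mem: "x \<in> S \<Longrightarrow> y \<in> S \<Longrightarrow> x + y \<in> S"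
  using diff_mem[of x "- y"] uminus_mem by simp

lemma sum_mem: "(\<And>i. i \<in> I \<Longrightarrow> f i \<in> S) \<Longrightarrow> sum f I \<in> S"
  by (induction I rule: infinite_finite_induct) (auto intro: zero_mem add_mem)

lemma prod_mem: "(\<And>i. i \<in> I \<Longrightarrow> f i \<in> S) \<Longrightarrow> prod f I \<in> S"
  by (induction I rule: infinite_finite_induct) (auto intro: one_mem mult_mem)

lemma power_mem: "x \<in> S \<Longrightarrow> x ^ k \<in> S"
  by (induction k) (auto intro: one_mem mult_mem)

lemma of_nat_mem: "of_nat k \<in> S"
  by (induction k) (auto intro: zero_mem one_mem add_mem)

lemma of_int_mem: "of_int k \<in> S"
  by (cases k rule: int_cases2) (auto intro: of_nat_mem uminus_mem)

lemmas mem = one_mem diff_mem mult_mem zero_mem uminus_mem add_mem sum_mem prod_mem power_mem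
  of_nat_mem of_int_mem

text \<open>Divisibility in the ambient field is trivial, so it is taken relative to
  \<open>S\<close>; \<open>d divides (a - b)\<close> serves as congruence modulo
  \<open>d\<close>.\<close>

definition divides :: "'a \<Rightarrow> 'a \<Rightarrow> bool" (infix \<open>divides\<close> 50) where
  "a divides b \<longleftrightarrow> (\<exists>c\<in>S. b = a * c)"

lemma dvI: "c \<in> S \<Longrightarrow> b = a * c \<Longrightarrow> a divides b"
  by (auto simp: divides_def)

lemma dv_refl: "a divides a"
  by (rule dvI[OF one_mem]) simp

lemma dv_zero: "a divides 0"
  by (rule dvI[OF zero_mem]) simp

lemma dv_add: "a divides x \<Longrightarrow> a divides y \<Longrightarrow> a divides (x + y)"
  unfolding divides_def by (metis add_mem distrib_left)

lemma dv_diff: "a divides x \<Longrightarrow> a divides y \<Longrightarrow> a divides (x - y)"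
  unfolding divides_def by (metis diff_mem right_diff_distrib)

lemma dv_mult: "a divides x \<Longrightarrow> b divides y \<Longrightarrow> (a * b) divides (x * y)"
  unfolding divides_def by (metis mult_mem mult.commute mult.left_commute)

lemma dv_mult_right: "a divides x \<Longrightarrow> y \<in> S \<Longrightarrow> a divides (x * y)"
  unfolding divides_def by (metis mult_mem mult.assoc)

lemma dv_mult_left: "a divides x \<Longrightarrow> y \<in> S \<Longrightarrow> a divides (y * x)"
  using dv_mult_right by (simp add: mult.commute)

lemma dv_uminus: "a divides x \<Longrightarrow> a divides (- x)"
  using dv_diff[OF dv_zero] by simp

lemma dv_trans: "a divides b \<Longrightarrow> b divides c \<Longrightarrow> a divides c"
  unfolding divides_def by (metis mult_mem mult.assoc)

lemma dv_sum: "(\<And>i. i \<in> I \<Longrightarrow> a divides f i) \<Longrightarrow> a divides sum f I"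
  by (induction I rule: infinite_finite_induct) (auto intro: dv_zero dv_add)

lemma dv_prod: "(\<And>i. i \<in> I \<Longrightarrow> f i divides h i) \<Longrightarrow> prod f I divides prod h I"
  by (induction I rule: infinite_finite_induct) (auto intro: dv_refl dv_mult)

lemma dv_power: "a divides x \<Longrightarrow> (a ^ k) divides (x ^ k)"
  by (induction k) (auto intro: dv_refl dv_mult)

lemma dv_power_le: "a \<in> S \<Longrightarrow> k \<le> l \<Longrightarrow> (a ^ k) divides (a ^ l)"
  by (rule dvI[of "a ^ (l - k)"]) (auto simp flip: power_add intro: power_mem)

lemma dv_power_mono: "a \<in> S \<Longrightarrow> k \<le> l \<Longrightarrow> (a ^ l) divides x \<Longrightarrow> (a ^ k) divides x"
  by (blast intro: dv_trans dv_power_le)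

lemma one_minus_dv: "x \<in> S \<Longrightarrow> (1 - x) divides (1 - x ^ k)"
  by (rule dvI[of "\<Sum>i<k. x ^ i"]) (auto simp: one_diff_power_eq intro: mem)

lemma cong_mult:
  assumes "d divides (a - b)" "d divides (x - y)" "a \<in> S" "y \<in> S"
  shows "d divides (a * x - b * y)"
proof -
  have "a * x - b * y = a * (x - y) + (a - b) * y"
    by (simp add: algebra_simps)
  then show ?thesis
    using assms by (auto intro: dv_add dv_mult_left dv_mult_right)
qed

lemma cong_prod:
  assumes "\<And>i. i \<in> I \<Longrightarrow> d divides (f i - h i)" "\<And>i. i \<in> I \<Longrightarrow> f i \<in> S" "\<And>i. i \<in> I \<Longrightarrow> h i \<in> S"
  shows "d divides (prod f I - prod h I)"
  using assms
  by (induction I rule: infinite_finite_induct) (auto intro!: cong_mult dv_zero prod_mem)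

lemma cong_power: "d divides (a - b) \<Longrightarrow> a \<in> S \<Longrightarrow> b \<in> S \<Longrightarrow> d divides (a ^ k - b ^ k)"
  using cong_prod[of "{..<k}" d "\<lambda>_. a" "\<lambda>_. b"] by simp

end

section \<open>Roots of unity of prime order and the geometric sum\<close>

lemma root_of_unity_power_coprime:
  fixes w :: "'a::field"
  assumes "w ^ p = 1" "coprime a p" "w ^ a = 1"
  shows "w = 1"
proof (cases "a = 0")
  case False
  then obtain x y where "a * x = p * y + 1"
    using bezout_nat[of a p] assms(2) by (auto simp: coprime_iff_gcd_eq_1)
  then have "(w ^ a) ^ x = (w ^ p) ^ y * w"
    by (simp flip: power_mult power_Suc2)
  with assms show ?thesis by simp
qed (use assms in simp)

lemma root_of_unity_powers_inj:
  fixes w :: "'a::field"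
  assumes "prime p" "w ^ p = 1" "w \<noteq> 1"
  shows "inj_on (\<lambda>l. w ^ l) {..<p}"
proof -
  have False if "a < b" "b < p" "w ^ a = w ^ b" for a b
  proof -
    have "w \<noteq> 0"
      using assms by (metis power_0_left prime_gt_0_nat less_irrefl zero_neq_one)
    then have "w ^ (b - a) = 1"
      using that by (simp add: power_diff)
    moreover have "coprime (b - a) p"
      using that assms(1)
      by (metis coprime_commute diff_is_0_eq' less_imp_diff_less linorder_not_less nat_dvd_not_less
          prime_imp_coprime zero_less_diff)
    ultimately show False
      using root_of_unity_power_coprime assms by blast
  qed
  then show ?thesis
    by (intro linorder_inj_onI') auto
qed

text \<open>Both sides are monic polynomials of degree \<open>p - 1\<close> in \<open>x\<close>, so
  agreement at the \<open>p - 1\<close> distinct points \<open>w ^ l\<close> suffices; there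
  \<open>1 - z ^ p\<close> vanishes but \<open>1 - z\<close> does not. At \<open>x = 1\<close> this
  is the factorisation of \<open>p\<close>.\<close>

lemma geometric_sum_eq_prod:
  fixes w x :: "'a::field"
  assumes "prime p" "w ^ p = 1" "w \<noteq> 1"
  shows "(\<Sum>l<p. x ^ l) = (\<Prod>l\<in>{1..<p}. x - w ^ l)"
proof -
  define P Q where "P = (\<Sum>l<p. monom (1::'a) l)" and "Q = (\<Prod>l\<in>{1..<p}. [:- (w ^ l), 1:])"
  have p: "p > 1" using assms(1) prime_gt_1_nat by auto
  have inj: "inj_on (\<lambda>l. w ^ l) {..<p}"
    using root_of_unity_powers_inj assms by blast
  have degQ: "degree Q = p - 1"
    unfolding Q_def by (subst degree_prod_eq_sum_degree) auto
  have lcQ: "lead_coeff Q = 1"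
    unfolding Q_def by (subst lead_coeff_prod) simp
  have cP: "coeff P i = (if i < p then 1 else 0)" for i
    by (simp add: P_def coeff_sum)
  have "P = Q"
  proof (rule poly_eqI_degree_lead_coeff[where n = "p - 1" and A = "(\<lambda>l. w ^ l) ` {1..<p}"])
    show "poly P z = poly Q z" if z: "z \<in> (\<lambda>l. w ^ l) ` {1..<p}" for z
    proof -
      obtain l where l: "l \<in> {1..<p}" "z = w ^ l" using z by auto
      have "poly Q z = 0"
        using l by (auto simp: Q_def poly_prod prod_zero_iff)
      moreover have "z \<noteq> 1"
        using inj_onD[OF inj, of l 0] l by auto
      moreover have "(1 - z) * poly P z = 1 - z ^ p"
        by (simp add: P_def poly_sum poly_monom one_diff_power_eq)
      moreover have "z ^ p = 1"
        using assms l by (metis power_mult mult.commute power_one)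
      ultimately show ?thesis by simp
    qed
    have "card ((\<lambda>l. w ^ l) ` {1..<p}) = p - 1"
      by (subst card_image) (auto intro: inj_on_subset[OF inj])
    then show "p - 1 \<le> card ((\<lambda>l. w ^ l) ` {1..<p})" by simp
    show "degree P \<le> p - 1" by (rule degree_le) (auto simp: cP)
    show "degree Q \<le> p - 1" by (simp add: degQ)
    show "coeff P (p - 1) = coeff Q (p - 1)" using cP lcQ degQ p by simp
  qed
  then have "poly P x = poly Q x" by simp
  then show ?thesis
    by (simp add: P_def Q_def poly_sum poly_monom poly_prod)
qed

text \<open>Since \<open>w\<close> is a power of \<open>x\<close>, each factor
  \<open>x - w ^ l\<close> is a difference of two multiples of \<open>1 - x\<close>. The statement
  for a general subring is applied to \<open>E\<close> as well as to \<open>S\<close>.\<close>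

lemma (in subring_set) geometric_sum_divisible:
  assumes "prime p" "w ^ p = 1" "w \<noteq> 1" "x \<in> S" "w = x ^ e"
  shows "((1 - x) ^ (p - 1)) divides (\<Sum>l<p. x ^ l)"
proof -
  have "(1 - x) divides (x - w ^ l)" for l
  proof -
    have "x - w ^ l = (1 - x ^ (e * l)) - (1 - x)"
      using assms(5) by (simp add: power_mult)
    then show ?thesis
      using dv_diff[OF one_minus_dv[OF assms(4)] dv_refl] by (simp only:)
  qed
  then have "(\<Prod>l\<in>{1..<p}. 1 - x) divides (\<Prod>l\<in>{1..<p}. x - w ^ l)"
    by (intro dv_prod)
  then show ?thesis
    using geometric_sum_eq_prod[OF assms(1-3), of x] by simp
qed

text \<open>\<open>g\<close> is a map of the whole field but respects the operations only on
  \<open>S\<close>, just as an element of \<open>galois_group\<close> is constrained only on its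
  field.\<close>

locale subring_hom = subring_set S for S :: "'a::field set" +
  fixes g :: "'a \<Rightarrow> 'a"
  assumes g_mem: "x \<in> S \<Longrightarrow> g x \<in> S"
    and g_one: "g 1 = 1"
    and g_add: "x \<in> S \<Longrightarrow> y \<in> S \<Longrightarrow> g (x + y) = g x + g y"
    and g_mult: "x \<in> S \<Longrightarrow> y \<in> S \<Longrightarrow> g (x * y) = g x * g y"
begin

lemma g_zero: "g 0 = 0"
  using g_add[of 0 0] zero_mem by (metis add.right_neutral add_left_cancel)

lemma g_uminus: "x \<in> S \<Longrightarrow> g (- x) = - g x"
  using g_add[of x "- x"] g_zero uminus_mem by (simp add: eq_neg_iff_add_eq_0 add.commute)

lemma g_diff: "x \<in> S \<Longrightarrow> y \<in> S \<Longrightarrow> g (x - y) = g x - g y"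
  using g_add[of x "- y"] g_uminus[of y] uminus_mem by simp

lemma g_power: "x \<in> S \<Longrightarrow> g (x ^ k) = g x ^ k"
  by (induction k) (auto simp: g_one g_mult power_mem)

lemma g_sum: "(\<And>i. i \<in> I \<Longrightarrow> f i \<in> S) \<Longrightarrow> g (sum f I) = (\<Sum>i\<in>I. g (f i))"
  by (induction I rule: infinite_finite_induct) (auto simp: g_zero g_add sum_mem)

lemma g_of_nat: "g (of_nat k) = of_nat k"
  by (induction k) (auto simp: g_zero g_add g_one one_mem of_nat_mem)

lemma g_of_int: "g (of_int k) = of_int k"
  by (cases k rule: int_cases2) (auto simp: g_of_nat g_uminus of_nat_mem)

end

section \<open>The cyclotomic tower\<close>

text \<open>Read \<open>a\<close> as the size of \<open>x\<close> and \<open>d\<close> as the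
  relative size of the increment \<open>h\<close>. Passing from \<open>k\<close> to
  \<open>k + 1\<close> multiplies the remainder by \<open>x + h\<close> and adds
  \<open>k x ^ (k - 1) h ^ 2\<close>, of size \<open>a ^ (k + 1) d ^ 2\<close>. The truncated
  exponent at \<open>k = 0\<close> is harmless because its factor is zero.\<close>

lemma (in subring_set) power_add_first_order:
  assumes "a divides x" "(a * d) divides h" "a \<in> S" "d \<in> S" "x \<in> S" "h \<in> S"
  shows "(a ^ k * d ^ 2) divides ((x + h) ^ k - x ^ k - of_nat k * x ^ (k - 1) * h)"
proof (induction k)
  case (Suc k)
  let ?R = "(x + h) ^ k - x ^ k - of_nat k * x ^ (k - 1) * h"
  have "a divides (x + h)"
    using dv_add[OF assms(1) dv_trans[OF dv_mult_right[OF dv_refl] assms(2)]] assms(4)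
    by simp
  then have 1: "(a * (a ^ k * d ^ 2)) divides ((x + h) * ?R)"
    using Suc by (rule dv_mult)
  have 2: "(a * (a ^ k * d ^ 2)) divides (of_nat k * x ^ (k - 1) * h * h)"
  proof (cases k)
    case (Suc j)
    have "(a ^ j * ((a * d) * (a * d))) divides (x ^ j * (h * h))"
      using assms by (intro dv_mult dv_power)
    then have "(a ^ j * ((a * d) * (a * d))) divides (of_nat k * (x ^ j * (h * h)))"
      by (rule dv_mult_left) (rule of_nat_mem)
    then show ?thesis
      by (simp add: Suc power2_eq_square mult_ac)
  qed (simp add: dv_zero)
  have "(x + h) ^ Suc k - x ^ Suc k - of_nat (Suc k) * x ^ (Suc k - 1) * h
      = (x + h) * ?R + of_nat k * x ^ (k - 1) * h * h"
    by (cases k) (simp_all add: algebra_simps)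
  then show ?case
    using dv_add[OF 1 2] by (simp add: mult.assoc)
qed (simp add: dv_zero)

lemma (in subring_set) power_add_cong:
  assumes "a divides x" "(a * d) divides h" "a \<in> S" "d \<in> S" "x \<in> S" "h \<in> S"
  shows "(a ^ k * d) divides ((x + h) ^ k - x ^ k)"
proof (cases k)
  case (Suc j)
  have 1: "(a ^ k * d) divides ((x + h) ^ k - x ^ k - of_nat k * x ^ (k - 1) * h)"
  proof (rule dv_trans)
    show "(a ^ k * d) divides (a ^ k * d ^ 2)"
      using assms by (intro dvI[of d]) (auto simp: power2_eq_square)
  qed (use assms in \<open>intro power_add_first_order\<close>)
  have "(a ^ j * (a * d)) divides (x ^ j * h)"
    using assms by (intro dv_mult dv_power)
  then have "(a ^ j * (a * d)) divides (of_nat k * (x ^ j * h))"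
    by (rule dv_mult_left) (rule of_nat_mem)
  moreover have "of_nat k * x ^ (k - 1) * h = of_nat k * (x ^ j * h)" "a ^ k * d = a ^ j * (a * d)"
    by (simp_all add: Suc mult_ac)
  ultimately have "(a ^ k * d) divides (of_nat k * x ^ (k - 1) * h)"
    by (simp only:)
  from dv_add[OF 1 this] show ?thesis by simp
qed (simp add: dv_zero)

text \<open>The two order conditions make \<open>Z\<close> a primitive root of unity of order
  \<open>p ^ Suc M\<close>, so \<open>Z ^ (p ^ M)\<close> has order \<open>p\<close>.\<close>

locale cyclotomic_subring = subring_set S for S :: "'a::field set" +
  fixes p M :: nat and Z :: 'a
  assumes prime: "prime p" and odd: "odd p"
    and Z_mem: "Z \<in> S"
    and Z_order: "Z ^ (p ^ Suc M) = 1" "Z ^ (p ^ M) \<noteq> 1"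
begin

definition pi :: "nat \<Rightarrow> 'a" where
  "pi k = 1 - Z ^ (p ^ k)"

text \<open>The \<open>p\<close>-th cyclotomic polynomial at \<open>Z ^ (p ^ k)\<close>, the factor
  that leads from \<open>pi k\<close> to \<open>pi (Suc k)\<close>.\<close>

definition geom :: "nat \<Rightarrow> 'a" where
  "geom k = (\<Sum>l<p. (Z ^ (p ^ k)) ^ l)"

lemma p_ge_3: "p \<ge> 3"
  using prime odd prime_ge_2_nat[of p] by (cases "p = 2") auto

lemma pi_mem: "pi k \<in> S"
  unfolding pi_def by (intro mem Z_mem)

lemma root: "(Z ^ (p ^ M)) ^ p = 1"
  using Z_order(1) by (simp flip: power_mult power_Suc2)

lemma pi_Suc: "pi (Suc k) = pi k * geom k"
  by (simp add: pi_def geom_def mult.commute[of p] power_mult one_diff_power_eq)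

lemma pi_power_divides_geom:
  assumes "k \<le> M"
  shows "(pi k ^ (p - 1)) divides geom k"
  unfolding pi_def geom_def
proof (rule geometric_sum_divisible[OF prime root Z_order(2)])
  show "Z ^ p ^ M = (Z ^ p ^ k) ^ p ^ (M - k)"
    using assms by (simp flip: power_mult power_add)
qed (intro mem Z_mem)

text \<open>\<open>geom k\<close> adds \<open>p - 1\<close> factors \<open>pi k\<close> to the one
  already in \<open>pi (Suc k)\<close>.\<close>

lemma power_divides_pi: "k \<le> M \<Longrightarrow> (pi 0 ^ (p ^ k)) divides pi k"
proof (induction k)
  case (Suc k)
  have "(pi k * pi k ^ (p - 1)) divides (pi k * geom k)"
    using Suc.prems by (intro dv_mult dv_refl pi_power_divides_geom) auto
  moreover have "pi k * pi k ^ (p - 1) = pi k ^ p"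
    using p_ge_3 by (simp flip: power_Suc)
  moreover have "((pi 0 ^ (p ^ k)) ^ p) divides (pi k ^ p)"
    using Suc by (intro dv_power) auto
  ultimately show ?case
    by (metis dv_trans pi_Suc power_Suc2 power_mult)
qed (simp add: dv_refl)

lemma p_eq_prod: "of_nat p = (\<Prod>l\<in>{1..<p}. 1 - (Z ^ p ^ M) ^ l)"
  using geometric_sum_eq_prod[OF prime root Z_order(2), of 1] by simp

text \<open>\<open>p\<close> is a product of \<open>p - 1\<close> factors, each a multiple of
  \<open>pi M\<close>. Together with \<open>p_divides_power\<close> this makes \<open>p\<close> an
  associate of that power of \<open>pi 0\<close>.\<close>

lemma power_divides_p: "(pi 0 ^ (p ^ M * (p - 1))) divides of_nat p"
proof -
  have "(\<Prod>l\<in>{1..<p}. pi M) divides (\<Prod>l\<in>{1..<p}. 1 - (Z ^ p ^ M) ^ l)"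
    unfolding pi_def by (intro dv_prod one_minus_dv mem Z_mem)
  then have "(pi M ^ (p - 1)) divides of_nat p"
    unfolding p_eq_prod by simp
  moreover have "((pi 0 ^ (p ^ M)) ^ (p - 1)) divides (pi M ^ (p - 1))"
    by (intro dv_power power_divides_pi) auto
  ultimately show ?thesis
    unfolding power_mult using dv_trans by blast
qed

text \<open>Modulo \<open>pi M\<close> every power of \<open>Z ^ (p ^ M)\<close> is 1, so
  \<open>geom k\<close> becomes \<open>(Z ^ (p ^ k) - 1) ^ (p - 1)\<close> and
  \<open>pi (Suc k)\<close> becomes \<open>pi k ^ p\<close>.\<close>

lemma pi_cong: "k \<le> M \<Longrightarrow> pi M divides (pi k - pi 0 ^ (p ^ k))"
proof (induction k)
  case (Suc k)
  let ?x = "Z ^ p ^ k"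
  have k: "k \<le> M" using Suc.prems by simp
  have "pi M divides ((\<Prod>l\<in>{1..<p}. ?x - (Z ^ p ^ M) ^ l) - (\<Prod>l\<in>{1..<p}. ?x - 1))"
  proof (rule cong_prod)
    show "pi M divides ((?x - (Z ^ p ^ M) ^ l) - (?x - 1))" for l
      using one_minus_dv[of "Z ^ p ^ M" l] Z_mem power_mem by (simp add: pi_def)
  qed (intro mem Z_mem)+
  \<comment> \<open>Oddness of \<open>p\<close> enters here: the sign of \<open>- pi k\<close>
    disappears in an even power.\<close>
  moreover have "(?x - 1) ^ (p - 1) = pi k ^ (p - 1)"
  proof -
    have "?x - 1 = - pi k" by (simp add: pi_def)
    moreover have "even (p - 1)" using odd by simp
    ultimately show ?thesis by (simp only: power_minus_even)
  qed
  ultimately have "pi M divides (geom k - pi k ^ (p - 1))"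
    using geometric_sum_eq_prod[OF prime root Z_order(2), of ?x] by (simp add: geom_def)
  then have "pi M divides (pi k * (geom k - pi k ^ (p - 1)))"
    by (intro dv_mult_left pi_mem)
  moreover have "pi k * pi k ^ (p - 1) = pi k ^ p"
    using p_ge_3 by (simp flip: power_Suc)
  ultimately have 1: "pi M divides (pi (Suc k) - pi k ^ p)"
    by (simp add: pi_Suc right_diff_distrib)
  have 2: "pi M divides (pi k ^ p - (pi 0 ^ (p ^ k)) ^ p)"
    using Suc k by (intro cong_power pi_mem power_mem) auto
  show ?case
    using dv_add[OF 1 2] by (simp add: mult.commute flip: power_mult)
qed (simp add: dv_zero)

lemma pi_cong_power: "k \<le> M \<Longrightarrow> (pi 0 ^ (p ^ M)) divides (pi k - pi 0 ^ (p ^ k))"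
  using pi_cong power_divides_pi[of M] dv_trans by blast

text \<open>With \<open>a\<close> inverse to \<open>i\<close> modulo \<open>p ^ Suc M\<close>, the
  \<open>a\<close>-th power of \<open>Z ^ i\<close> is \<open>Z\<close> again. The cofactor is
  displayed because \<open>diff_g_eigen\<close> needs it in the smaller ring
  \<open>E\<close>.\<close>

lemma pi_inverse:
  assumes "coprime i p"
  obtains a where "(1 - (Z ^ (p ^ k)) ^ i) * (\<Sum>j<a. ((Z ^ (p ^ k)) ^ i) ^ j) = pi k"
proof -
  have "coprime i (p ^ Suc M)" using assms by simp
  moreover have "i \<noteq> 0"
    using assms prime by (intro notI) (simp add: prime_nat_iff)
  ultimately obtain a b where ab: "i * a = p ^ Suc M * b + 1"
    using bezout_nat[of i "p ^ Suc M"] by (auto simp: coprime_iff_gcd_eq_1)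
  have "((Z ^ (p ^ k)) ^ i) ^ a = (Z ^ (i * a)) ^ p ^ k"
    by (simp add: mult_ac flip: power_mult)
  also have "Z ^ (i * a) = (Z ^ p ^ Suc M) ^ b * Z"
    unfolding ab by (simp add: power_add power_mult)
  finally have "1 - ((Z ^ (p ^ k)) ^ i) ^ a = pi k"
    using Z_order by (simp add: pi_def)
  then show ?thesis
    using that[of a] by (simp add: one_diff_power_eq)
qed

text \<open>Each factor of \<open>p\<close> divides \<open>pi M\<close>, and \<open>pi M\<close>
  divides \<open>pi 0 ^ (p ^ M)\<close> by \<open>pi_cong\<close> at \<open>k = M\<close>. Later
  this makes a high power of an element of \<open>filt 1\<close> a multiple of
  \<open>p\<close>.\<close>

lemma p_divides_power: "of_nat p divides (pi 0 ^ (p ^ M * (p - 1)))"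
proof -
  have "(1 - (Z ^ p ^ M) ^ l) divides pi M" if "l \<in> {1..<p}" for l
  proof -
    have "coprime l p"
      using that prime by (metis atLeastLessThan_iff coprime_commute less_eq_Suc_le nat_dvd_not_less
          One_nat_def prime_imp_coprime)
    then obtain a where "(1 - (Z ^ (p ^ M)) ^ l) * (\<Sum>j<a. ((Z ^ (p ^ M)) ^ l) ^ j) = pi M"
      by (rule pi_inverse)
    then show ?thesis
      by (intro dvI[of "\<Sum>j<a. ((Z ^ (p ^ M)) ^ l) ^ j"] mem Z_mem) simp
  qed
  then have "(\<Prod>l\<in>{1..<p}. 1 - (Z ^ p ^ M) ^ l) divides (\<Prod>l\<in>{1..<p}. pi M)"
    by (rule dv_prod)
  then have "of_nat p divides (pi M ^ (p - 1))"
    unfolding p_eq_prod by simp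
  moreover have "pi M divides (pi 0 ^ (p ^ M))"
    using dv_diff[OF dv_refl pi_cong[of M]] by simp
  ultimately show ?thesis
    unfolding power_mult using dv_trans dv_power by blast
qed

end

section \<open>The operator 1 - g on the cyclotomic ring\<close>

locale twisted_cyclotomic_subring = cyclotomic_subring S p M Z + subring_hom S g
  for S :: "'a::field set" and p M Z g +
  fixes r :: nat
  assumes g_Z: "g Z = Z ^ (1 + p ^ r)"
    and r_pos: "r \<ge> 1"
    and r_le: "r + 2 \<le> M"
begin

lemma g_pi0_divides: "pi 0 divides g (pi 0)"
proof -
  have "g (pi 0) = 1 - Z ^ (1 + p ^ r)"
    using g_Z by (simp add: pi_def g_diff g_one one_mem Z_mem)
  then show ?thesis
    using one_minus_dv[OF Z_mem, of "1 + p ^ r"] by (simp add: pi_def)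
qed

text \<open>Elements almost fixed by \<open>g\<close>: \<open>Z ^ p\<close> qualifies, while
  \<open>Z\<close> is moved by \<open>Z\<close> times \<open>pi r\<close>. Division inside
  \<open>E\<close> keeps cofactors almost fixed, hence the separate divisibility
  \<open>E.divides\<close>.\<close>

definition E :: "'a set" where
  "E = {x \<in> S. pi (Suc r) divides (x - g x)}"

sublocale E: subring_set E
proof
  show "1 \<in> E" by (simp add: E_def one_mem g_one dv_zero)
  fix x y assume xy: "x \<in> E" "y \<in> E"
  have "pi (Suc r) divides ((x - g x) - (y - g y))"
    using xy by (auto simp: E_def intro: dv_diff[where x = "x - g x"])
  then show "x - y \<in> E"
    using xy by (auto simp: E_def g_diff mem algebra_simps)
  have "pi (Suc r) divides (x * y - g x * g y)"
    using xy by (intro cong_mult) (auto simp: E_def g_mem)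
  then show "x * y \<in> E"
    using xy by (auto simp: E_def g_mult mem)
qed

lemma E_subset: "x \<in> E \<Longrightarrow> x \<in> S"
  by (simp add: E_def)

lemma Zp_mem_E: "Z ^ p \<in> E"
proof -
  have "Z ^ p - g (Z ^ p) = Z ^ p * pi (Suc r)"
    using g_Z by (simp add: g_power Z_mem pi_def algebra_simps flip: power_mult power_add)
  then show ?thesis
    by (auto simp: E_def intro: mem Z_mem dv_mult_left dv_refl)
qed

text \<open>As \<open>r \<ge> 1\<close>, \<open>Z ^ (p ^ r)\<close> is a power of
  \<open>Z ^ p\<close>. Hence \<open>1 - Z ^ (p ^ r)\<close> to the power \<open>p - 1\<close>
  divides the geometric sum inside \<open>E\<close>, and \<open>pi 1\<close> divides
  \<open>1 - Z ^ (p ^ r)\<close> there; \<open>p - 1 \<ge> 2\<close> leaves two factors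
  \<open>pi 1\<close>.\<close>

lemma geom_r_E: "E.divides (pi 1 ^ 2) (geom r)"
proof -
  have z: "Z ^ p ^ r = (Z ^ p) ^ p ^ (r - 1)"
    using r_pos by (simp flip: power_mult power_Suc)
  then have "E.divides ((1 - Z ^ p ^ r) ^ (p - 1)) (geom r)"
    unfolding geom_def
  proof (intro E.geometric_sum_divisible[OF prime root Z_order(2)])
    show "Z ^ p ^ M = (Z ^ p ^ r) ^ p ^ (M - r)"
      using r_le by (simp flip: power_mult power_add)
  qed (auto intro: E.mem Zp_mem_E)
  moreover have "E.divides (pi 1 ^ (p - 1)) ((1 - Z ^ p ^ r) ^ (p - 1))"
    unfolding z by (intro E.dv_power) (auto simp: pi_def intro: E.one_minus_dv Zp_mem_E)
  moreover have "E.divides (pi 1 ^ 2) (pi 1 ^ (p - 1))"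
    using p_ge_3 by (intro E.dv_power_le) (auto simp: pi_def intro: E.mem Zp_mem_E)
  ultimately show ?thesis
    using E.dv_trans by blast
qed

lemma g_pi1: "g (pi 1) = pi 1 + (1 - pi 1) * pi (Suc r)"
  using g_Z by (simp add: pi_def g_diff g_one one_mem g_power Z_mem power_mem algebra_simps
      flip: power_mult power_add)

text \<open>In powers of \<open>pi 0\<close>, \<open>pi 1\<close> has size \<open>p\<close> and its
  increment under \<open>g\<close> has size \<open>p ^ Suc r\<close>; \<open>delta\<close> is the
  relative size.\<close>

abbreviation (input) delta where "delta \<equiv> p ^ Suc r - p"

lemma p_add_delta: "p + delta = p ^ Suc r"
  using p_ge_3 r_pos by (simp add: self_le_power)

text \<open>Equivalent to \<open>p \<le> delta\<close>, which puts the second-order error, of order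
  \<open>p * m + 2 * delta\<close>, beyond \<open>p ^ Suc r + p * m\<close>.\<close>

lemma p_le_delta: "2 * p \<le> p ^ Suc r"
proof -
  have "2 * p \<le> p * p ^ r"
    using p_ge_3 r_pos self_le_power[of p r] by (simp add: mult.commute)
  then show ?thesis by simp
qed

lemma pi1_divides: "(pi 0 ^ p) divides pi 1"
  using power_divides_pi[of 1] r_le by simp

lemma increment_divides: "(pi 0 ^ p * pi 0 ^ delta) divides ((1 - pi 1) * pi (Suc r))"
  using power_divides_pi[of "Suc r"] r_le p_add_delta
  by (simp flip: power_add) (intro dv_mult_left mem pi_mem, simp)

text \<open>For \<open>g (pi 1) = pi 1 + h\<close> the expansion leaves
  \<open>m pi 1 ^ (m - 1) h\<close>. Replacing \<open>h\<close> by \<open>pi (Suc r)\<close> costs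
  \<open>m pi 1 ^ m pi (Suc r)\<close>, which reaches the modulus exactly.\<close>

lemma diff_g_pi1_power:
  assumes "m \<ge> 1"
  shows "(pi 0 ^ (p ^ Suc r + p * m)) divides
    (pi 1 ^ m - g (pi 1 ^ m) + of_nat m * (pi 1 ^ (m - 1) * pi (Suc r)))"
proof -
  let ?I = "(divides) (pi 0 ^ (p ^ Suc r + p * m))" and ?h = "(1 - pi 1) * pi (Suc r)"
  have "((pi 0 ^ p) ^ m * (pi 0 ^ delta) ^ 2) divides
      ((pi 1 + ?h) ^ m - pi 1 ^ m - of_nat m * pi 1 ^ (m - 1) * ?h)"
    by (intro power_add_first_order pi1_divides increment_divides mem pi_mem)
  moreover have "(pi 0 ^ p) ^ m * (pi 0 ^ delta) ^ 2 = pi 0 ^ (p * m + delta * 2)"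
    by (simp only: power_mult power_add)
  moreover have "p ^ Suc r + p * m \<le> p * m + delta * 2"
    using p_le_delta by linarith
  ultimately have 1: "?I ((pi 1 + ?h) ^ m - pi 1 ^ m - of_nat m * pi 1 ^ (m - 1) * ?h)"
    using dv_power_mono[OF pi_mem] by metis
  have "((pi 0 ^ p) ^ m * pi 0 ^ (p ^ Suc r)) divides (pi 1 ^ m * pi (Suc r))"
    using r_le by (intro dv_mult dv_power pi1_divides power_divides_pi) auto
  moreover have "(pi 0 ^ p) ^ m * pi 0 ^ (p ^ Suc r) = pi 0 ^ (p ^ Suc r + p * m)"
    by (simp only: power_mult power_add add.commute[of "p ^ Suc r"])
  ultimately have "?I (pi 1 ^ m * pi (Suc r))"
    by (simp only:)
  then have 2: "?I (of_nat m * (pi 1 ^ m * pi (Suc r)))"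
    by (rule dv_mult_left) (rule of_nat_mem)
  obtain j where j: "m = Suc j" using assms by (cases m) auto
  have "g (pi 1 ^ m) = (pi 1 + ?h) ^ m"
    by (simp only: g_power pi_mem g_pi1)
  then have "pi 1 ^ m - g (pi 1 ^ m) + of_nat m * (pi 1 ^ (m - 1) * pi (Suc r)) =
      - ((pi 1 + ?h) ^ m - pi 1 ^ m - of_nat m * pi 1 ^ (m - 1) * ?h) +
      of_nat m * (pi 1 ^ m * pi (Suc r))"
    by (simp add: j algebra_simps)
  then show ?thesis
    using dv_add[OF dv_uminus[OF 1] 2] by (simp only:)
qed

text \<open>The product rule separates \<open>pi 1 ^ Suc m * (x - g x)\<close> from the change of
  \<open>pi 1 ^ Suc m\<close>. The latter has order \<open>p * Suc m + delta\<close>, equal to the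
  required bound; this is why the exponent is \<open>Suc m\<close>.\<close>

lemma diff_g_E:
  assumes "x \<in> E"
  shows "(pi 0 ^ (p ^ Suc r + p * m)) divides (pi 1 ^ Suc m * x - g (pi 1 ^ Suc m * x))"
proof -
  let ?I = "(divides) (pi 0 ^ (p ^ Suc r + p * m))" and ?h = "(1 - pi 1) * pi (Suc r)"
  have "((pi 0 ^ p) ^ Suc m * pi 0 ^ delta) divides ((pi 1 + ?h) ^ Suc m - pi 1 ^ Suc m)"
    by (intro power_add_cong pi1_divides increment_divides mem pi_mem)
  moreover have "(pi 0 ^ p) ^ Suc m * pi 0 ^ delta = pi 0 ^ (p * Suc m + delta)"
    by (simp only: power_mult power_add)
  moreover have "p * Suc m + delta = p ^ Suc r + p * m"
    using p_add_delta by simp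
  ultimately have 1: "?I (g (pi 1) ^ Suc m - pi 1 ^ Suc m)"
    using g_pi1 by metis
  have "((pi 0 ^ p) ^ Suc m * pi 0 ^ (p ^ Suc r)) divides (pi 1 ^ Suc m * (x - g x))"
    using assms r_le power_divides_pi[of "Suc r"]
    by (intro dv_mult dv_power pi1_divides) (auto simp: E_def intro: dv_trans)
  moreover have "(pi 0 ^ p) ^ Suc m * pi 0 ^ (p ^ Suc r) = pi 0 ^ (p * Suc m + p ^ Suc r)"
    by (simp only: power_mult power_add)
  moreover have "p ^ Suc r + p * m \<le> p * Suc m + p ^ Suc r" by simp
  ultimately have 2: "?I (pi 1 ^ Suc m * (x - g x))"
    using dv_power_mono[OF pi_mem] by metis
  have 3: "?I ((g (pi 1) ^ Suc m - pi 1 ^ Suc m) * g x)"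
    using 1 assms by (intro dv_mult_right g_mem E_subset)
  have "g (pi 1 ^ Suc m * x) = g (pi 1) ^ Suc m * g x"
    by (simp only: g_mult g_power mem pi_mem E_subset[OF assms])
  then have "pi 1 ^ Suc m * x - g (pi 1 ^ Suc m * x) =
      pi 1 ^ Suc m * (x - g x) - (g (pi 1) ^ Suc m - pi 1 ^ Suc m) * g x"
    by (simp only: algebra_simps)
  then show ?thesis
    using dv_diff[OF 2 3] by (simp only:)
qed

text \<open>
  On \<open>Z ^ i * E\<close> with \<open>p\<close> not dividing \<open>i\<close> the operator \<open>1 - g\<close> is, to first order, multiplication by
  \<open>1 - Z ^ (i * p ^ r)\<close>, an associate of \<open>pi r\<close>, which divides \<open>pi (Suc r)\<close>; so \<open>1 - g\<close> can be
  inverted there.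
\<close>

lemma diff_g_eigen:
  assumes "m \<ge> 1" "i \<in> {1..<p}"
  shows "\<exists>y\<in>S. (pi 0 ^ (p * m)) divides y \<and>
    (pi 0 ^ (p ^ Suc r + p * m)) divides (y - g y - Z ^ i * (pi 1 ^ (m - 1) * pi (Suc r)))"
proof -
  let ?z = "Z ^ p ^ r"
  have "coprime i p"
    using assms(2) prime by (metis atLeastLessThan_iff coprime_commute less_eq_Suc_le
        nat_dvd_not_less One_nat_def prime_imp_coprime)
  then obtain a where a: "(1 - ?z ^ i) * (\<Sum>j<a. (?z ^ i) ^ j) = pi r"
    by (rule pi_inverse)
  have zE: "?z \<in> E"
  proof -
    have "?z = (Z ^ p) ^ p ^ (r - 1)"
      using r_pos by (simp flip: power_mult power_Suc)
    then show ?thesis by (auto intro: E.mem Zp_mem_E)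
  qed
  define q where "q = (\<Sum>j<a. (?z ^ i) ^ j)"
  have q: "q \<in> E" unfolding q_def by (intro E.mem zE)
  obtain h where h: "h \<in> E" "geom r = pi 1 ^ 2 * h"
    using geom_r_E by (auto simp: E.divides_def)
  obtain j where j: "m = Suc j" using assms by (cases m) auto
  \<comment> \<open>\<open>pi (Suc r)\<close> factors as
    \<open>(1 - ?z ^ i) * q * pi 1 ^ 2 * h\<close>, so this \<open>e\<close> solves
    \<open>(1 - ?z ^ i) * e = pi 1 ^ (m - 1) * pi (Suc r)\<close> exactly. The square raises the
    exponent to the \<open>Suc m\<close> of \<open>diff_g_E\<close>.\<close>
  define e where "e = pi 1 ^ Suc m * (h * q)"
  have hq: "h * q \<in> E" using h q E.mem by blast
  have eS: "e \<in> S" unfolding e_def by (intro mem pi_mem E_subset hq)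
  have "(1 - ?z ^ i) * e = pi 1 ^ j * (pi 1 ^ 2 * h) * ((1 - ?z ^ i) * q)"
    by (simp add: e_def j power2_eq_square)
  then have e: "(1 - ?z ^ i) * e = pi 1 ^ (m - 1) * pi (Suc r)"
    using a h(2) by (simp add: q_def j pi_Suc mult_ac)
  show ?thesis
  proof (intro bexI conjI)
    show "Z ^ i * e \<in> S" by (intro mem Z_mem eS)
    have "((pi 0 ^ p) ^ Suc m * 1) divides e"
      unfolding e_def using E_subset[OF hq]
      by (intro dv_mult dv_power pi1_divides) (auto intro: dvI)
    moreover have "(pi 0 ^ p) ^ Suc m * 1 = pi 0 ^ (p * Suc m)"
      by (simp only: power_mult power_add mult_1_right)
    ultimately have "(pi 0 ^ (p * m)) divides e"
      using dv_power_mono[OF pi_mem, of "p * m" "p * Suc m"] by (metis add.commute le_add1 mult_Suc_right)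
    then show "(pi 0 ^ (p * m)) divides (Z ^ i * e)"
      by (intro dv_mult_left mem Z_mem)
    have "g (Z ^ i * e) = (Z * ?z) ^ i * g e"
      using g_Z by (simp add: g_mult g_power mem Z_mem eS)
    then have "Z ^ i * e - g (Z ^ i * e) = Z ^ i * ((1 - ?z ^ i) * e) + Z ^ i * ?z ^ i * (e - g e)"
      by (simp add: power_mult_distrib algebra_simps)
    then have "Z ^ i * e - g (Z ^ i * e) - Z ^ i * (pi 1 ^ (m - 1) * pi (Suc r))
        = Z ^ i * ?z ^ i * (e - g e)"
      unfolding e by simp
    moreover have "(pi 0 ^ (p ^ Suc r + p * m)) divides (e - g e)"
      unfolding e_def using hq by (rule diff_g_E)
    ultimately show "(pi 0 ^ (p ^ Suc r + p * m)) divides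
        (Z ^ i * e - g (Z ^ i * e) - Z ^ i * (pi 1 ^ (m - 1) * pi (Suc r)))"
      by (auto intro!: dv_mult_left mem Z_mem)
  qed
qed

text \<open>\<open>pi 1\<close> and \<open>pi (Suc r)\<close> agree with \<open>pi 0 ^ p\<close> and
  \<open>pi 0 ^ (p ^ Suc r)\<close> up to at least one further factor \<open>pi 0\<close>; the
  exponents \<open>p * (m - 1)\<close>, \<open>p ^ Suc r\<close> and \<open>p - 1\<close> add up to
  one less than that of the modulus.\<close>

lemma leading_term_cong:
  assumes "m \<ge> 1"
  shows "(pi 0 ^ (p ^ Suc r + p * m)) divides
    (pi 1 ^ (m - 1) * pi (Suc r) * pi 0 ^ (p - 1) - pi 0 ^ (p ^ Suc r + p * m - 1))"
proof -
  obtain j where j: "m = Suc j" using assms by (cases m) auto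
  have e1: "p ^ Suc r + p * m = (p * j + 1) + p ^ Suc r + (p - 1)"
    and e2: "p ^ Suc r + p * m - 1 = p * j + p ^ Suc r + (p - 1)"
    using p_ge_3 by (simp_all add: j)
  \<comment> \<open>Rests on \<open>r + 2 \<le> M\<close>, which comes from
    \<open>s \<ge> 3\<close>: the approximation of \<open>pi (Suc r)\<close> holds modulo
    \<open>pi 0 ^ (p ^ M)\<close>, and this must lie beyond the leading term.\<close>
  have r2: "p ^ Suc r + 1 \<le> p ^ M"
    by (metis Suc_eq_plus1 Suc_leI add_2_eq_Suc' less_le_trans lessI nat_le_linear
        power_increasing power_strict_increasing_iff prime prime_gt_0_nat prime_gt_1_nat r_le Suc_leI)
  have p2: "p + 1 \<le> p ^ M"
    using r2 p_le_delta by linarith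
  have "(pi 0 ^ (p + 1)) divides (pi 1 - pi 0 ^ (p ^ 1))"
    using r_le by (intro dv_power_mono[OF pi_mem p2] pi_cong_power) auto
  then have "((pi 0 ^ p) ^ j * pi 0) divides ((pi 0 ^ p + (pi 1 - pi 0 ^ p)) ^ j - (pi 0 ^ p) ^ j)"
    by (intro power_add_cong mem pi_mem dv_refl) (simp add: mult.commute)
  moreover have "(pi 0 ^ p) ^ j * pi 0 = pi 0 ^ (p * j + 1)"
    by (simp only: power_mult power_add power_one_right)
  ultimately have "(pi 0 ^ (p * j + 1)) divides (pi 1 ^ j - pi 0 ^ (p * j))"
    by (simp add: power_mult)
  then have 1: "(pi 0 ^ (p * j + 1) * pi 0 ^ (p ^ Suc r)) divides
      ((pi 1 ^ j - pi 0 ^ (p * j)) * pi 0 ^ (p ^ Suc r))"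
    by (intro dv_mult dv_refl)
  have "(pi 0 ^ (p ^ Suc r + 1)) divides (pi (Suc r) - pi 0 ^ (p ^ Suc r))"
    using r_le by (intro dv_power_mono[OF pi_mem r2] pi_cong_power) auto
  then have 2: "((pi 0 ^ p) ^ j * pi 0 ^ (p ^ Suc r + 1)) divides
      (pi 1 ^ j * (pi (Suc r) - pi 0 ^ (p ^ Suc r)))"
    by (intro dv_mult dv_power pi1_divides)
  have 3: "(pi 0 ^ p) ^ j * pi 0 ^ (p ^ Suc r + 1) = pi 0 ^ (p * j + 1) * pi 0 ^ (p ^ Suc r)"
    by (simp add: power_add power_mult)
  have "(pi 0 ^ (p * j + 1) * pi 0 ^ (p ^ Suc r)) divides
      (pi 1 ^ j * pi (Suc r) - pi 0 ^ (p * j) * pi 0 ^ (p ^ Suc r))"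
    using dv_add[OF 1 2[unfolded 3]] by (simp add: algebra_simps)
  from dv_mult[OF this dv_refl[of "pi 0 ^ (p - 1)"]] show ?thesis
    unfolding e2 unfolding e1 by (simp add: j power_add left_diff_distrib mult.assoc)
qed

lemma exists_diff_g:
  assumes m: "m \<ge> 1" "\<not> p dvd m"
  shows "\<exists>y\<in>S. (pi 0 ^ (p * m)) divides y \<and>
    (pi 0 ^ (p ^ Suc r + p * m)) divides (y - g y - pi 0 ^ (p ^ Suc r + p * m - 1))"
proof -
  let ?n = "p ^ Suc r + p * m"
  let ?W = "pi 1 ^ (m - 1) * pi (Suc r)"
  \<comment> \<open>Signed coefficients of \<open>(1 - Z) ^ (p - 1)\<close>. Index 0 is outside the
    range of \<open>diff_g_eigen\<close>, so \<open>y1\<close> reaches only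
    \<open>pi 0 ^ (p - 1) - 1\<close> times \<open>?W\<close>.\<close>
  define c where "c i = (-1) ^ i * int ((p - 1) choose i)" for i
  let ?c = "\<lambda>i. of_int (c i) :: 'a"
  obtain Y where Y: "\<And>i. i \<in> {1..<p} \<Longrightarrow> Y i \<in> S \<and> (pi 0 ^ (p * m)) divides Y i \<and>
      (pi 0 ^ ?n) divides (Y i - g (Y i) - Z ^ i * ?W)"
    using diff_g_eigen[OF m(1)] by metis
  define y1 where "y1 = (\<Sum>i\<in>{1..<p}. ?c i * Y i)"
  have y1S: "y1 \<in> S" unfolding y1_def using Y by (intro mem) auto
  have y1: "(pi 0 ^ (p * m)) divides y1"
    unfolding y1_def using Y by (intro dv_sum dv_mult_left[OF _ of_int_mem]) auto
  have "pi 0 ^ (p - 1) = (- Z + 1) ^ (p - 1)"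
    by (simp add: pi_def)
  also have "\<dots> = (\<Sum>i\<le>p - 1. ?c i * Z ^ i)"
    unfolding binomial_ring by (intro sum.cong refl) (simp add: c_def power_minus[of Z] mult_ac)
  also have "{..p - 1} = insert 0 {1..<p}"
    using p_ge_3 by auto
  finally have bin: "(\<Sum>i\<in>{1..<p}. ?c i * Z ^ i) = pi 0 ^ (p - 1) - 1"
    by (simp add: c_def)
  have "(pi 0 ^ ?n) divides (\<Sum>i\<in>{1..<p}. ?c i * (Y i - g (Y i) - Z ^ i * ?W))"
    using Y by (intro dv_sum dv_mult_left[OF _ of_int_mem]) auto
  also have "(\<Sum>i\<in>{1..<p}. ?c i * (Y i - g (Y i) - Z ^ i * ?W)) =
      y1 - (\<Sum>i\<in>{1..<p}. ?c i * g (Y i)) - (\<Sum>i\<in>{1..<p}. ?c i * Z ^ i) * ?W"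
    unfolding y1_def by (simp only: sum_subtractf right_diff_distrib sum_distrib_right mult.assoc)
  also have "(\<Sum>i\<in>{1..<p}. ?c i * g (Y i)) = g y1"
    unfolding y1_def using Y by (subst g_sum) (auto intro!: sum.cong mult_mem of_int_mem simp: g_mult of_int_mem g_of_int)
  finally have I1: "(pi 0 ^ ?n) divides (y1 - g y1 - (pi 0 ^ (p - 1) - 1) * ?W)"
    unfolding bin .
  have I2: "(pi 0 ^ ?n) divides (pi 1 ^ m - g (pi 1 ^ m) + of_nat m * ?W)"
    using m(1) by (rule diff_g_pi1_power)
  \<comment> \<open>\<open>- pi 1 ^ m\<close> reaches \<open>m\<close> times \<open>?W\<close>, the
    constant term missing from \<open>of_nat m * y1\<close>.\<close>
  define y2 where "y2 = of_nat m * y1 - pi 1 ^ m"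
  have y2S: "y2 \<in> S" unfolding y2_def by (intro mem y1S pi_mem)
  have "((pi 0 ^ p) ^ m) divides (pi 1 ^ m)"
    by (intro dv_power pi1_divides)
  then have y2: "(pi 0 ^ (p * m)) divides y2"
    unfolding y2_def using dv_diff[OF dv_mult_left[OF y1 of_nat_mem]] by (simp add: power_mult)
  define X Q where "X = ?W * pi 0 ^ (p - 1)" and "Q = pi 0 ^ (?n - 1)"
  have "g y2 = of_nat m * g y1 - g (pi 1 ^ m)"
    unfolding y2_def by (simp add: g_diff g_mult mem y1S pi_mem g_of_nat)
  then have "y2 - g y2 - of_nat m * X =
      of_nat m * (y1 - g y1 - (pi 0 ^ (p - 1) - 1) * ?W) -
      (pi 1 ^ m - g (pi 1 ^ m) + of_nat m * ?W)"
    unfolding y2_def X_def by (simp add: algebra_simps)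
  then have I3: "(pi 0 ^ ?n) divides (y2 - g y2 - of_nat m * X)"
    using dv_diff[OF dv_mult_left[OF I1 of_nat_mem] I2] by (simp only:)
  \<comment> \<open>\<open>a\<close> inverts \<open>m\<close> modulo \<open>p\<close>. The
    discrepancy \<open>b * p * X\<close> is negligible, since \<open>pi 0 ^ (?n - 1)\<close> divides
    \<open>X\<close> and \<open>pi 0\<close> divides \<open>p\<close>.\<close>
  obtain a b where ab: "m * a = p * b + 1"
  proof -
    have "coprime m p"
      using m prime by (metis coprime_commute prime_imp_coprime)
    then show ?thesis
      using bezout_nat[of m p] m that by (auto simp: coprime_iff_gcd_eq_1)
  qed
  have lead: "(pi 0 ^ ?n) divides (X - Q)"
    unfolding X_def Q_def using leading_term_cong[OF m(1)] .
  have "(pi 0 ^ (?n - 1)) divides (X - Q)"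
    using lead by (rule dv_power_mono[OF pi_mem, rotated]) simp
  from dv_add[OF this, of Q] have "(pi 0 ^ (?n - 1)) divides X"
    by (simp add: Q_def dv_refl)
  moreover have "(pi 0 ^ 1) divides of_nat p"
  proof (rule dv_power_mono[OF pi_mem _ power_divides_p])
    show "1 \<le> p ^ M * (p - 1)"
      using p_ge_3 by simp
  qed
  ultimately have "(pi 0 ^ (?n - 1) * pi 0 ^ 1) divides (X * of_nat p)"
    by (rule dv_mult)
  moreover have "pi 0 ^ (?n - 1) * pi 0 ^ 1 = pi 0 ^ ?n"
    using p_ge_3 by (simp only: flip: power_add) simp
  ultimately have "(pi 0 ^ ?n) divides (X * of_nat p)"
    by (simp only:)
  then have I4: "(pi 0 ^ ?n) divides (of_nat b * (X * of_nat p))"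
    by (rule dv_mult_left) (rule of_nat_mem)
  define y where "y = of_nat a * y2"
  have yS: "y \<in> S" unfolding y_def by (intro mem y2S)
  have gy: "g y = of_nat a * g y2"
    unfolding y_def by (simp add: g_mult mem y2S g_of_nat)
  have "of_nat m * of_nat a = (of_nat p * of_nat b + 1 :: 'a)"
    using arg_cong[OF ab, of of_nat] by (simp add: add.commute)
  then have "of_nat m * of_nat a * X = (of_nat p * of_nat b + 1) * X"
    by (simp only:)
  moreover have "of_nat a * (y2 - g y2 - of_nat m * X) + of_nat b * (X * of_nat p) + (X - Q) =
      of_nat a * y2 - of_nat a * g y2 - of_nat m * of_nat a * X + (of_nat p * of_nat b + 1) * X - Q"
    by (simp add: algebra_simps)
  ultimately have "y - g y - Q =
      of_nat a * (y2 - g y2 - of_nat m * X) + of_nat b * (X * of_nat p) + (X - Q)"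
    unfolding gy unfolding y_def by auto
  moreover have "(pi 0 ^ ?n) divides
      (of_nat a * (y2 - g y2 - of_nat m * X) + of_nat b * (X * of_nat p) + (X - Q))"
    by (rule dv_add[OF dv_add[OF dv_mult_left[OF I3 of_nat_mem] I4] lead])
  ultimately have "(pi 0 ^ ?n) divides (y - g y - Q)"
    by (simp only:)
  moreover have "(pi 0 ^ (p * m)) divides y"
    unfolding y_def by (rule dv_mult_left[OF y2 of_nat_mem])
  ultimately have "\<exists>y\<in>S. (pi 0 ^ (p * m)) divides y \<and> (pi 0 ^ ?n) divides (y - g y - Q)"
    using yS by blast
  then show ?thesis by (simp only: Q_def)
qed

end

section \<open>Cyclic algebras as rings\<close>

text \<open>Moving the window by one trades \<open>h i\<close> for the equal term
  \<open>h (i + N)\<close>. It re-indexes the sums in \<open>mult_assoc\<close>.\<close>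

lemma sum_periodic_shift:
  fixes h :: "nat \<Rightarrow> 'a::ab_group_add"
  assumes "\<And>l. h (l + N) = h l"
  shows "(\<Sum>j<N. h (i + j)) = (\<Sum>l<N. h l)"
proof (induction i)
  case (Suc i)
  have "(\<Sum>j<N. h (Suc i + j)) + h i = (\<Sum>j<Suc N. h (i + j))"
    by (simp add: sum.lessThan_Suc_shift del: sum.lessThan_Suc)
  also have "\<dots> = (\<Sum>j<N. h (i + j)) + h i"
    using assms by simp
  finally show ?case using Suc by simp
qed simp

text \<open>The coefficients form a \<open>g\<close>-stable subring rather than a field, so that the
  order itself is an instance. Associativity rests on \<open>g_period\<close> and
  \<open>g_c\<close>, invertibility of \<open>u_gen\<close> on \<open>c\<close> being a unit of
  \<open>S\<close>.\<close>

locale cyclic_order = subring_hom S g for S :: "'a::field set" and g +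
  fixes N :: nat and c :: 'a
  assumes N_gt_1: "N > 1"
    and c_mem: "c \<in> S" "inverse c \<in> S" and c_nonzero: "c \<noteq> 0"
    and g_c: "g c = c"
    and g_period: "x \<in> S \<Longrightarrow> (g ^^ N) x = x"
begin

abbreviation R :: "(nat \<Rightarrow> 'a) ring" where
  "R \<equiv> cyclic_algebra N g c S"

lemma carrier_iff: "x \<in> carrier R \<longleftrightarrow> (\<forall>j<N. x j \<in> S) \<and> (\<forall>j\<ge>N. x j = 0)"
  by (simp add: cyclic_algebra_def)

lemma coeff_mem: "x \<in> carrier R \<Longrightarrow> x j \<in> S"
  by (cases "j < N") (auto simp: carrier_iff zero_mem)

lemma ring_ops: "\<zero>\<^bsub>R\<^esub> = (\<lambda>k. 0)" "\<one>\<^bsub>R\<^esub> = scalar 1" "x \<oplus>\<^bsub>R\<^esub> y = (\<lambda>k. x k + y k)"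
  by (simp_all add: cyclic_algebra_def scalar_def)

abbreviation ge :: "nat \<Rightarrow> 'a \<Rightarrow> 'a" where
  "ge i \<equiv> g ^^ i"

lemma ge_mem: "x \<in> S \<Longrightarrow> ge i x \<in> S"
  by (induction i) (auto intro: g_mem)

lemma ge_add: "x \<in> S \<Longrightarrow> y \<in> S \<Longrightarrow> ge i (x + y) = ge i x + ge i y"
  by (induction i) (auto simp: g_add ge_mem)

lemma ge_mult: "x \<in> S \<Longrightarrow> y \<in> S \<Longrightarrow> ge i (x * y) = ge i x * ge i y"
  by (induction i) (auto simp: g_mult ge_mem)

lemma ge_zero: "ge i 0 = 0"
  by (induction i) (auto simp: g_zero)

lemma ge_fixed: "g x = x \<Longrightarrow> ge i x = x"
  by (induction i) auto

lemma ge_sum: "(\<And>j. j \<in> J \<Longrightarrow> f j \<in> S) \<Longrightarrow> ge i (sum f J) = (\<Sum>j\<in>J. ge i (f j))"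
  by (induction J rule: infinite_finite_induct) (auto simp: ge_zero ge_add sum_mem)

lemma g_inverse_c: "g (inverse c) = inverse c"
proof -
  have "g (c * inverse c) = c * g (inverse c)"
    using c_mem g_c by (simp only: g_mult)
  then show ?thesis
    using c_nonzero by (simp add: g_one field_simps)
qed

lemma c_powi_mem: "c powi k \<in> S"
  by (auto simp: power_int_def c_mem intro: power_mem)

lemma g_c_powi: "g (c powi k) = c powi k"
  by (auto simp: power_int_def g_power c_mem g_c g_inverse_c)

text \<open>
  The coefficient function \<open>x\<close> extended to all integers by \<open>u\<^sup>k = c u\<^sup>k\<^sup>-\<^sup>N\<close>; products then become
  twisted convolutions without wrap-around.
\<close>

definition ext :: "(nat \<Rightarrow> 'a) \<Rightarrow> int \<Rightarrow> 'a" where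
  "ext x k = x (nat (k mod int N)) * c powi (- (k div int N))"

lemma ext_mem: "x \<in> carrier R \<Longrightarrow> ext x k \<in> S"
  by (simp add: ext_def mult_mem coeff_mem c_powi_mem)

lemma ext_shift: "ext x (k + int N * t) = ext x k * c powi (- t)"
  using N_gt_1 c_nonzero by (simp add: ext_def power_int_add power_int_diff power_int_minus field_simps)

lemma ext_of_nat: "k < N \<Longrightarrow> ext x (int k) = x k"
  by (simp add: ext_def)

lemma ext_diff:
  assumes "i < N" "k < N"
  shows "ext x (int k - int i) = (if i \<le> k then x (k - i) else x (k + N - i) * c)"
proof (cases "i \<le> k")
  case True
  then show ?thesis
    using ext_of_nat[of "k - i" x] assms by (simp add: of_nat_diff)
next
  case False
  then have "int k - int i = int (k + N - i) + int N * (- 1)"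
    using assms by (simp add: of_nat_diff)
  then show ?thesis
    using False assms ext_shift[of x "int (k + N - i)" "- 1"] ext_of_nat[of "k + N - i" x] by simp
qed

text \<open>For given \<open>i\<close> exactly one \<open>j < N\<close> satisfies one of the two
  conditions in the product; \<open>ext\<close> selects it together with its factor
  \<open>c\<close>.\<close>

lemma mult_coeff:
  assumes "y \<in> carrier R" "k < N"
  shows "(x \<otimes>\<^bsub>R\<^esub> y) k = (\<Sum>i<N. x i * ge i (ext y (int k - int i)))"
proof -
  have "(\<Sum>j<N. if i + j = k then x i * ge i (y j) else if i + j = k + N then x i * ge i (y j) * c else 0)
      = x i * ge i (ext y (int k - int i))" if "i < N" for i
  proof (cases "i \<le> k")
    case True
    then have "(\<Sum>j<N. if i + j = k then x i * ge i (y j) else if i + j = k + N then x i * ge i (y j) * c else 0)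
      = (\<Sum>j<N. if j = k - i then x i * ge i (y j) else 0)"
      by (intro sum.cong) auto
    then show ?thesis
      using True that assms by (simp add: ext_diff sum.delta)
  next
    case False
    then have "(\<Sum>j<N. if i + j = k then x i * ge i (y j) else if i + j = k + N then x i * ge i (y j) * c else 0)
      = (\<Sum>j<N. if j = k + N - i then x i * ge i (y j) * c else 0)"
      using that by (intro sum.cong) auto
    then show ?thesis
      using False that assms
      by (simp add: ext_diff sum.delta ge_mult coeff_mem c_mem ge_fixed g_c)
  qed
  then show ?thesis
    using assms(2) by (simp add: cyclic_algebra_def)
qed

lemma mult_coeff_ge: "k \<ge> N \<Longrightarrow> (x \<otimes>\<^bsub>R\<^esub> y) k = 0"
  by (simp add: cyclic_algebra_def)

lemma mult_closed: "x \<in> carrier R \<Longrightarrow> y \<in> carrier R \<Longrightarrow> x \<otimes>\<^bsub>R\<^esub> y \<in> carrier R"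
  by (intro carrier_iff[THEN iffD2] conjI allI impI)
    (simp_all add: mult_coeff mult_coeff_ge sum_mem mult_mem ge_mem ext_mem coeff_mem)

lemma ext_mult:
  assumes "x \<in> carrier R" "y \<in> carrier R"
  shows "ext (x \<otimes>\<^bsub>R\<^esub> y) k = (\<Sum>i<N. x i * ge i (ext y (k - int i)))"
proof -
  let ?a = "k mod int N" and ?b = "k div int N"
  have "ext y (k - int i) = ext y (?a - int i) * c powi (- ?b)" for i
    using ext_shift[of y "?a - int i" ?b] by (simp add: algebra_simps)
  then have "ge i (ext y (k - int i)) = ge i (ext y (?a - int i)) * c powi (- ?b)" for i
    using assms by (simp add: ge_mult ext_mem c_powi_mem ge_fixed g_c_powi)
  moreover have "nat ?a < N"
    using N_gt_1 by (simp add: nat_less_iff)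
  moreover have "int (nat ?a) = ?a"
    using N_gt_1 by simp
  ultimately show ?thesis
    using assms by (simp add: ext_def[of "x \<otimes>\<^bsub>R\<^esub> y"] mult_coeff sum_distrib_right mult.assoc)
qed

text \<open>With \<open>l = i + j\<close> both bracketings become sums of
  \<open>x i * h i l\<close>. Each \<open>h i\<close> has period \<open>N\<close>, because a shift
  of \<open>l\<close> by \<open>N\<close> brings in \<open>c\<close> and its inverse and
  \<open>g\<close> iterated \<open>N\<close> times is the identity on \<open>S\<close>. Hence
  \<open>j\<close> and \<open>l\<close> may both run over a full period.\<close>

lemma mult_assoc:
  assumes "x \<in> carrier R" "y \<in> carrier R" "z \<in> carrier R"
  shows "(x \<otimes>\<^bsub>R\<^esub> y) \<otimes>\<^bsub>R\<^esub> z = x \<otimes>\<^bsub>R\<^esub> (y \<otimes>\<^bsub>R\<^esub> z)"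
proof
  fix k
  show "((x \<otimes>\<^bsub>R\<^esub> y) \<otimes>\<^bsub>R\<^esub> z) k = (x \<otimes>\<^bsub>R\<^esub> (y \<otimes>\<^bsub>R\<^esub> z)) k"
  proof (cases "k < N")
    case True
    define h where "h i l = ge i (ext y (int l - int i)) * ge l (ext z (int k - int l))" for i l
    have h_period: "h i (l + N) = h i l" for i l
    proof -
      have 1: "ext y (int (l + N) - int i) = ext y (int l - int i) * inverse c"
        using ext_shift[of y "int l - int i" 1] by (simp add: algebra_simps)
      have 2: "ext z (int k - int (l + N)) = ext z (int k - int l) * c"
        using ext_shift[of z "int k - int l" "- 1"] by (simp add: algebra_simps)
      have 3: "ge (l + N) v = ge l v" if "v \<in> S" for v
        using g_period[OF that] by (simp add: funpow_add)
      show ?thesis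
        unfolding h_def 1 2 using assms c_nonzero
        by (simp add: 3 ge_mult ext_mem c_mem mult_mem ge_fixed g_c g_inverse_c)
    qed
    have "((x \<otimes>\<^bsub>R\<^esub> y) \<otimes>\<^bsub>R\<^esub> z) k = (\<Sum>l<N. \<Sum>i<N. x i * h i l)"
      using True assms
      by (simp add: mult_coeff h_def sum_distrib_right mult.assoc)
    also have "\<dots> = (\<Sum>i<N. x i * (\<Sum>l<N. h i l))"
      by (subst sum.swap) (simp add: sum_distrib_left)
    also have "\<dots> = (\<Sum>i<N. x i * (\<Sum>j<N. h i (i + j)))"
      by (intro sum.cong refl arg_cong2[where f = "(*)"] sum_periodic_shift[symmetric] h_period)
    also have "\<dots> = (\<Sum>i<N. x i * ge i (ext (y \<otimes>\<^bsub>R\<^esub> z) (int k - int i)))"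
    proof (intro sum.cong refl arg_cong2[where f = "(*)"])
      fix i
      have "ge i (ext (y \<otimes>\<^bsub>R\<^esub> z) (int k - int i)) =
          (\<Sum>j<N. ge i (y j * ge j (ext z (int k - int i - int j))))"
        using assms by (simp add: ext_mult ge_sum mult_mem coeff_mem ge_mem ext_mem)
      also have "\<dots> = (\<Sum>j<N. h i (i + j))"
        using assms by (intro sum.cong refl)
          (simp add: h_def ge_mult coeff_mem ge_mem ext_mem funpow_add ext_of_nat diff_diff_eq)
      finally show "(\<Sum>j<N. h i (i + j)) = ge i (ext (y \<otimes>\<^bsub>R\<^esub> z) (int k - int i))" by simp
    qed
    also have "\<dots> = (x \<otimes>\<^bsub>R\<^esub> (y \<otimes>\<^bsub>R\<^esub> z)) k"
      using True assms by (subst mult_coeff) (auto intro: mult_closed)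
    finally show ?thesis .
  qed (simp add: mult_coeff_ge)
qed

lemma scalar_closed: "b \<in> S \<Longrightarrow> scalar b \<in> carrier R"
  using N_gt_1 by (auto simp: carrier_iff scalar_def zero_mem)

lemma scalar_mult:
  assumes "x \<in> carrier R"
  shows "scalar b \<otimes>\<^bsub>R\<^esub> x = (\<lambda>k. b * x k)"
proof
  fix k
  show "(scalar b \<otimes>\<^bsub>R\<^esub> x) k = b * x k"
  proof (cases "k < N")
    case True
    then have "(scalar b \<otimes>\<^bsub>R\<^esub> x) k = (\<Sum>i<N. if i = 0 then b * ext x (int k) else 0)"
      using assms by (simp only: mult_coeff) (intro sum.cong, auto simp: scalar_def)
    then show ?thesis
      using True N_gt_1 by (simp add: sum.delta ext_of_nat)
  qed (use assms in \<open>simp add: mult_coeff_ge carrier_iff\<close>)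
qed

lemma mult_scalar:
  assumes "x \<in> carrier R" "b \<in> S"
  shows "x \<otimes>\<^bsub>R\<^esub> scalar b = (\<lambda>k. x k * ge k b)"
proof
  fix k
  show "(x \<otimes>\<^bsub>R\<^esub> scalar b) k = x k * ge k b"
  proof (cases "k < N")
    case True
    then have "(x \<otimes>\<^bsub>R\<^esub> scalar b) k = (\<Sum>i<N. if i = k then x k * ge k b else 0)"
      using assms
      by (simp only: mult_coeff scalar_closed)
        (intro sum.cong, auto simp: ext_diff scalar_def ge_zero)
    then show ?thesis
      using True by (simp add: sum.delta)
  qed (use assms in \<open>simp add: mult_coeff_ge carrier_iff\<close>)
qed

text \<open>On coefficients fixed by \<open>g\<close> the twist disappears, and the defining double
  sum is symmetric.\<close>

lemma mult_comm_fixed: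
  assumes "\<And>i. g (x i) = x i" "\<And>i. g (y i) = y i"
  shows "x \<otimes>\<^bsub>R\<^esub> y = y \<otimes>\<^bsub>R\<^esub> x"
proof
  fix k
  have "(\<Sum>i<N. \<Sum>j<N. if i + j = k then x i * y j else if i + j = k + N then x i * y j * c else 0)
    = (\<Sum>j<N. \<Sum>i<N. if j + i = k then y j * x i else if j + i = k + N then y j * x i * c else 0)"
    by (subst sum.swap) (intro sum.cong refl, auto simp: add.commute mult.commute)
  then show "(x \<otimes>\<^bsub>R\<^esub> y) k = (y \<otimes>\<^bsub>R\<^esub> x) k"
    using assms[THEN ge_fixed] by (simp add: cyclic_algebra_def cong: if_cong)
qed

lemma ext_add: "ext (\<lambda>k. x k + y k) j = ext x j + ext y j"
  by (simp add: ext_def distrib_right)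

lemma add_closed: "x \<in> carrier R \<Longrightarrow> y \<in> carrier R \<Longrightarrow> (\<lambda>k. x k + y k) \<in> carrier R"
  by (auto simp: carrier_iff add_mem)

lemma is_ring: "ring R"
proof (rule ringI)
  show "abelian_group R"
  proof (rule abelian_groupI)
    show "\<exists>y\<in>carrier R. y \<oplus>\<^bsub>R\<^esub> x = \<zero>\<^bsub>R\<^esub>" if "x \<in> carrier R" for x
      using that by (intro bexI[of _ "\<lambda>k. - x k"]) (auto simp: ring_ops carrier_iff uminus_mem)
  qed (auto simp: ring_ops carrier_iff add_mem zero_mem algebra_simps)
  show "Group.monoid R"
  proof (rule monoidI)
    show "\<one>\<^bsub>R\<^esub> \<otimes>\<^bsub>R\<^esub> x = x" if "x \<in> carrier R" for x
      using that by (simp add: ring_ops scalar_mult)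
    show "x \<otimes>\<^bsub>R\<^esub> \<one>\<^bsub>R\<^esub> = x" if "x \<in> carrier R" for x
      using that by (simp add: ring_ops mult_scalar one_mem ge_fixed g_one)
  qed (auto simp: ring_ops mult_closed mult_assoc scalar_closed one_mem)
  fix x y z assume xyz: "x \<in> carrier R" "y \<in> carrier R" "z \<in> carrier R"
  show "(x \<oplus>\<^bsub>R\<^esub> y) \<otimes>\<^bsub>R\<^esub> z = x \<otimes>\<^bsub>R\<^esub> z \<oplus>\<^bsub>R\<^esub> y \<otimes>\<^bsub>R\<^esub> z"
  proof
    show "((x \<oplus>\<^bsub>R\<^esub> y) \<otimes>\<^bsub>R\<^esub> z) k = (x \<otimes>\<^bsub>R\<^esub> z \<oplus>\<^bsub>R\<^esub> y \<otimes>\<^bsub>R\<^esub> z) k" for k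
      using xyz by (cases "k < N")
        (simp_all add: ring_ops mult_coeff mult_coeff_ge distrib_right sum.distrib)
  qed
  show "z \<otimes>\<^bsub>R\<^esub> (x \<oplus>\<^bsub>R\<^esub> y) = z \<otimes>\<^bsub>R\<^esub> x \<oplus>\<^bsub>R\<^esub> z \<otimes>\<^bsub>R\<^esub> y"
  proof
    show "(z \<otimes>\<^bsub>R\<^esub> (x \<oplus>\<^bsub>R\<^esub> y)) k = (z \<otimes>\<^bsub>R\<^esub> x \<oplus>\<^bsub>R\<^esub> z \<otimes>\<^bsub>R\<^esub> y) k" for k
      using xyz by (cases "k < N")
        (simp_all add: ring_ops mult_coeff mult_coeff_ge add_closed ext_add ge_add ext_mem
          distrib_left sum.distrib)
  qed
qed

sublocale ring R by (rule is_ring)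

lemma a_inv_eq: "x \<in> carrier R \<Longrightarrow> \<ominus>\<^bsub>R\<^esub> x = (\<lambda>k. - x k)"
  by (intro minus_equality) (auto simp: ring_ops carrier_iff uminus_mem)

lemma a_minus_eq: "x \<in> carrier R \<Longrightarrow> y \<in> carrier R \<Longrightarrow> x \<ominus>\<^bsub>R\<^esub> y = (\<lambda>k. x k - y k)"
  by (simp add: a_minus_def a_inv_eq ring_ops)

lemma a_minus_coeff: "x \<in> carrier R \<Longrightarrow> y \<in> carrier R \<Longrightarrow> (x \<ominus>\<^bsub>R\<^esub> y) k = x k - y k"
  by (simp add: a_minus_eq)

lemma scalar_scalar: "b \<in> S \<Longrightarrow> scalar a \<otimes>\<^bsub>R\<^esub> scalar b = scalar (a * b)"
  using scalar_mult[OF scalar_closed, of b a] by (auto simp: scalar_def)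

lemma scalar_pow: "b \<in> S \<Longrightarrow> scalar b [^]\<^bsub>R\<^esub> (k::nat) = scalar (b ^ k)"
  by (induction k) (auto simp: ring_ops nat_pow_Suc scalar_scalar mult.commute)

lemma u_gen_closed: "u_gen \<in> carrier R"
  using N_gt_1 by (auto simp: carrier_iff u_gen_def zero_mem one_mem)

lemma u_gen_scalar:
  assumes "b \<in> S"
  shows "u_gen \<otimes>\<^bsub>R\<^esub> scalar b = scalar (g b) \<otimes>\<^bsub>R\<^esub> u_gen"
  unfolding mult_scalar[OF u_gen_closed assms] scalar_mult[OF u_gen_closed]
  by (auto simp: u_gen_def)

lemma u_gen_Units: "u_gen \<in> Units R"
proof -
  \<comment> \<open>The inverse of \<open>u\<close> is the inverse of \<open>c\<close> times
    \<open>u ^ (N - 1)\<close>.\<close>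
  define v where "v = (\<lambda>k. if k = N - 1 then inverse c else 0)"
  have v: "v \<in> carrier R"
    using N_gt_1 by (auto simp: carrier_iff v_def zero_mem c_mem)
  have uv: "u_gen \<otimes>\<^bsub>R\<^esub> v = \<one>\<^bsub>R\<^esub>"
  proof
    fix k
    show "(u_gen \<otimes>\<^bsub>R\<^esub> v) k = \<one>\<^bsub>R\<^esub> k"
    proof (cases "k < N")
      case True
      then have "(u_gen \<otimes>\<^bsub>R\<^esub> v) k = (\<Sum>i<N. if i = 1 then g (ext v (int k - int 1)) else 0)"
        using v by (simp only: mult_coeff) (intro sum.cong, auto simp: u_gen_def)
      also have "\<dots> = g (ext v (int k - int 1))"
        using N_gt_1 by (subst sum.delta) auto
      also have "\<dots> = \<one>\<^bsub>R\<^esub> k"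
        using True N_gt_1 c_nonzero by (subst ext_diff) (auto simp: v_def g_one g_zero ring_ops scalar_def)
      finally show ?thesis .
    qed (use N_gt_1 in \<open>simp add: mult_coeff_ge ring_ops scalar_def\<close>)
  qed
  have "v \<otimes>\<^bsub>R\<^esub> u_gen = u_gen \<otimes>\<^bsub>R\<^esub> v"
    by (rule mult_comm_fixed) (auto simp: v_def u_gen_def g_zero g_one g_inverse_c)
  then show ?thesis
    using uv v u_gen_closed by (auto simp: Units_def)
qed

end

section \<open>Units and commutators\<close>

text \<open>Generators are eliminated one at a time: writing \<open>e a\<close> as
  \<open>l + P t\<close> and expanding \<open>t\<close> expresses
  \<open>(1 - P \<rho> a) e a\<close> by \<open>L\<close> and the other generators, and that factor
  is invertible. \<open>L\<close> is closed only under addition and scalars from \<open>S\<close>,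
  so a left ideal of a noncommutative ring can be used.\<close>

lemma (in subring_set) nakayama:
  fixes e :: "'b \<Rightarrow> 'i \<Rightarrow> 'a"
  assumes "finite I" and P: "P \<in> S" "\<And>x. x \<in> S \<Longrightarrow> \<exists>v\<in>S. v * (1 - P * x) = 1"
    and L_add: "\<And>x y. x \<in> L \<Longrightarrow> y \<in> L \<Longrightarrow> (\<lambda>k. x k + y k) \<in> L"
    and L_scale: "\<And>a x. a \<in> S \<Longrightarrow> x \<in> L \<Longrightarrow> (\<lambda>k. a * x k) \<in> L"
    and e: "\<And>i. i \<in> I \<Longrightarrow> e i \<in> V"
    and span: "\<And>x. x \<in> V \<Longrightarrow> \<exists>l\<in>L. \<exists>\<rho>. (\<forall>i. \<rho> i \<in> S) \<and> x = (\<lambda>k. l k + (\<Sum>i\<in>I. \<rho> i * e i k))"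
    and split: "\<And>x. x \<in> V \<Longrightarrow> \<exists>l\<in>L. \<exists>t\<in>V. x = (\<lambda>k. l k + P * t k)"
    and x: "x \<in> V"
  shows "x \<in> L"
  using assms(1) e span x
proof (induction I arbitrary: x rule: finite_induct)
  case empty
  then show ?case by fastforce
next
  case (insert a I)
  obtain l t where l: "l \<in> L" and t: "t \<in> V" and ea: "e a = (\<lambda>k. l k + P * t k)"
    using split[OF insert.prems(1)[of a]] by auto
  obtain l' \<rho> where l': "l' \<in> L" and \<rho>: "\<And>i. \<rho> i \<in> S"
    and t_eq: "t = (\<lambda>k. l' k + (\<Sum>i\<in>insert a I. \<rho> i * e i k))"
    using insert.prems(2)[OF t] by auto
  obtain v where v: "v \<in> S" "v * (1 - P * \<rho> a) = 1"
    using P(2)[OF \<rho>[of a]] by blast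
  define l2 where "l2 = (\<lambda>k. v * (l k + P * l' k))"
  have l2: "l2 \<in> L"
    unfolding l2_def using l l' by (intro L_scale L_add v P(1))
  have ea2: "e a k = l2 k + (\<Sum>i\<in>I. v * (P * \<rho> i) * e i k)" for k
  proof -
    have "e a k = l k + P * (l' k + (\<rho> a * e a k + (\<Sum>i\<in>I. \<rho> i * e i k)))"
      using fun_cong[OF ea, of k] insert.hyps by (simp add: t_eq)
    then have "(1 - P * \<rho> a) * e a k = l k + P * l' k + P * (\<Sum>i\<in>I. \<rho> i * e i k)"
      by (simp add: algebra_simps)
    then have "v * (1 - P * \<rho> a) * e a k = v * (l k + P * l' k + P * (\<Sum>i\<in>I. \<rho> i * e i k))"
      by (simp only: mult.assoc)
    then show ?thesis
      by (simp add: v(2) l2_def distrib_left sum_distrib_left mult.assoc)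
  qed
  show ?case
  proof (rule insert.IH)
    show "e i \<in> V" if "i \<in> I" for i using insert.prems(1) that by simp
    show "\<exists>l\<in>L. \<exists>\<rho>. (\<forall>i. \<rho> i \<in> S) \<and> x = (\<lambda>k. l k + (\<Sum>i\<in>I. \<rho> i * e i k))" if x: "x \<in> V" for x
    proof -
      obtain l3 \<sigma> where l3: "l3 \<in> L" and \<sigma>: "\<And>i. \<sigma> i \<in> S"
        and x_eq: "x = (\<lambda>k. l3 k + (\<Sum>i\<in>insert a I. \<sigma> i * e i k))"
        using insert.prems(2)[OF x] by auto
      have "x k = l3 k + \<sigma> a * l2 k + (\<Sum>i\<in>I. (\<sigma> a * (v * (P * \<rho> i)) + \<sigma> i) * e i k)" for k
      proof -
        have "x k = l3 k + (\<sigma> a * e a k + (\<Sum>i\<in>I. \<sigma> i * e i k))"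
          using insert.hyps by (simp add: x_eq)
        then show ?thesis
          unfolding ea2 by (simp add: distrib_left distrib_right sum.distrib sum_distrib_left mult.assoc)
      qed
      moreover have "(\<lambda>k. l3 k + \<sigma> a * l2 k) \<in> L"
        using l3 l2 \<sigma> by (intro L_add L_scale)
      moreover have "\<sigma> a * (v * (P * \<rho> i)) + \<sigma> i \<in> S" for i
        using \<sigma> v \<rho> P by (intro mem)
      ultimately show ?thesis
        by (intro bexI[of _ "\<lambda>k. l3 k + \<sigma> a * l2 k"] exI[of _ "\<lambda>i. \<sigma> a * (v * (P * \<rho> i)) + \<sigma> i"]) auto
    qed
  qed (use insert.prems(3) in simp)
qed

text \<open>A left inverse \<open>w\<close> of \<open>1 - P z\<close> equals
  \<open>1 + P w z\<close>, again of the form that has a left inverse \<open>w'\<close>. An element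
  with inverses on both sides has them equal, so \<open>w'\<close> is
  \<open>1 - P z\<close>.\<close>

lemma (in ring) unit_of_left_inverses:
  assumes P: "P \<in> carrier R" "\<And>x. x \<in> carrier R \<Longrightarrow> P \<otimes> x = x \<otimes> P"
    and left: "\<And>z. z \<in> carrier R \<Longrightarrow> \<exists>w\<in>carrier R. w \<otimes> (\<one> \<ominus> P \<otimes> z) = \<one>"
    and z: "z \<in> carrier R"
  shows "\<one> \<ominus> P \<otimes> z \<in> Units R"
proof -
  obtain w where w: "w \<in> carrier R" "w \<otimes> (\<one> \<ominus> P \<otimes> z) = \<one>"
    using left[OF z] by blast
  have "w \<otimes> (P \<otimes> z) = (w \<otimes> P) \<otimes> z"
    using P(1) w(1) z by (simp add: m_assoc)
  also have "\<dots> = P \<otimes> (w \<otimes> z)"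
    unfolding P(2)[OF w(1), symmetric] using P(1) w(1) z by (simp add: m_assoc)
  finally have "w \<otimes> (P \<otimes> z) = P \<otimes> (w \<otimes> z)" .
  then have "w \<ominus> P \<otimes> (w \<otimes> z) = \<one>"
    using w z P(1) by (simp add: minus_eq r_distr r_minus)
  then have "w = \<one> \<oplus> P \<otimes> (w \<otimes> z)"
    using w(1) z P(1) by (metis a_comm add.inv_solve_right' m_closed minus_eq one_closed)
  then have "w = \<one> \<ominus> P \<otimes> (\<ominus> (w \<otimes> z))"
    using w(1) z P(1) by (simp add: minus_eq r_minus)
  then obtain w' where w': "w' \<in> carrier R" "w' \<otimes> w = \<one>"
    using left[of "\<ominus> (w \<otimes> z)"] w z by auto
  have "w' = w' \<otimes> (w \<otimes> (\<one> \<ominus> P \<otimes> z))"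
    using w w' by simp
  also have "\<dots> = \<one> \<ominus> P \<otimes> z"
    using w' w(1) P(1) z by (simp add: minus_closed flip: m_assoc)
  finally show ?thesis
    using w w' by (auto simp: Units_def)
qed

text \<open>\<open>1 - a ^ k\<close> is \<open>1 - a\<close> times the geometric sum
  \<open>s\<close> on either side, which yields a left and a right inverse of
  \<open>1 - a\<close>.\<close>

lemma (in ring) unit_one_minus:
  assumes a: "a \<in> carrier R" and unit: "\<one> \<ominus> a [^] (k::nat) \<in> Units R"
  shows "\<one> \<ominus> a \<in> Units R"
proof -
  have "\<exists>s\<in>carrier R. s \<otimes> (\<one> \<ominus> a) = \<one> \<ominus> a [^] k \<and> (\<one> \<ominus> a) \<otimes> s = \<one> \<ominus> a [^] k"
  proof (induction k)
    case 0
    then show ?case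
      using a by (intro bexI[of _ \<zero>]) (auto simp: minus_eq r_neg)
  next
    case (Suc k)
    then obtain s where s: "s \<in> carrier R" "s \<otimes> (\<one> \<ominus> a) = \<one> \<ominus> a [^] k"
      "(\<one> \<ominus> a) \<otimes> s = \<one> \<ominus> a [^] k" by blast
    have tele: "(\<one> \<ominus> x) \<oplus> (x \<ominus> y) = \<one> \<ominus> y" if "x \<in> carrier R" "y \<in> carrier R" for x y
      using that by (simp add: minus_eq a_assoc r_neg1)
    have comm: "a \<otimes> a [^] k = a [^] k \<otimes> a"
      using a by (metis nat_pow_Suc nat_pow_Suc2)
    have "(s \<oplus> a [^] k) \<otimes> (\<one> \<ominus> a) = (\<one> \<ominus> a [^] k) \<oplus> (a [^] k \<ominus> a [^] Suc k)"
      using s a by (simp add: l_distr) (simp add: minus_eq r_distr r_minus)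
    moreover have "(\<one> \<ominus> a) \<otimes> (s \<oplus> a [^] k) = (\<one> \<ominus> a [^] k) \<oplus> (a [^] k \<ominus> a [^] Suc k)"
      using s a by (simp add: r_distr minus_closed)
        (simp add: minus_eq l_distr l_minus comm)
    ultimately show ?case
      using tele[of "a [^] k" "a [^] Suc k"] s a by (intro bexI[of _ "s \<oplus> a [^] k"]) auto
  qed
  then obtain s where s: "s \<in> carrier R" "s \<otimes> (\<one> \<ominus> a) = \<one> \<ominus> a [^] k"
    "(\<one> \<ominus> a) \<otimes> s = \<one> \<ominus> a [^] k" by blast
  let ?b = "\<one> \<ominus> a" and ?t = "inv (\<one> \<ominus> a [^] k)"
  have b: "?b \<in> carrier R" and t: "?t \<in> carrier R" using a unit by auto
  have 1: "?b \<otimes> (s \<otimes> ?t) = \<one>"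
    using s b t unit by (simp flip: m_assoc)
  have 2: "(?t \<otimes> s) \<otimes> ?b = \<one>"
    using s b t unit by (simp add: m_assoc)
  have "?t \<otimes> s = (?t \<otimes> s) \<otimes> (?b \<otimes> (s \<otimes> ?t))"
    using 1 s t by simp
  also have "\<dots> = ((?t \<otimes> s) \<otimes> ?b) \<otimes> (s \<otimes> ?t)"
    using s(1) b t by (simp add: m_assoc)
  also have "\<dots> = s \<otimes> ?t"
    using 2 s t by simp
  finally show ?thesis
    using 1 2 s b t by (auto simp: Units_def)
qed

text \<open>\<open>R0\<close> will be the power series over the ring of integers of
  \<open>F\<close>: fixed by \<open>g\<close>, with \<open>p\<close> in its Jacobson radical, and
  with \<open>S\<close> spanned over it by finitely many powers of \<open>Z\<close>.\<close>

locale twisted_order = twisted_cyclotomic_subring S p M Z g r + cyclic_order S g N c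
  for S :: "'a::field set" and p M Z g r N c +
  fixes R0 :: "'a set" and K :: nat
  assumes R0_subring: "subring_set R0"
    and R0_subset: "x \<in> R0 \<Longrightarrow> x \<in> S"
    and g_R0: "x \<in> R0 \<Longrightarrow> g x = x"
    and R0_span: "b \<in> S \<Longrightarrow> \<exists>\<beta>. (\<forall>i. \<beta> i \<in> R0) \<and> b = (\<Sum>i<K. \<beta> i * Z ^ i)"
    and R0_jacobson: "x \<in> R0 \<Longrightarrow> \<exists>v\<in>R0. v * (1 - of_nat p * x) = 1"
begin

text \<open>Since \<open>p\<close> is central, \<open>x = x (1 - p z) + p (x z)\<close>, so the left
  ideal \<open>L\<close> generated by \<open>1 - p z\<close> fills the ring modulo \<open>p\<close>.
  Nakayama over \<open>R0\<close> then puts 1 into \<open>L\<close>.\<close>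

lemma left_inverse_one_minus_p:
  assumes z: "z \<in> carrier R"
  shows "\<exists>w\<in>carrier R. w \<otimes>\<^bsub>R\<^esub> (\<one>\<^bsub>R\<^esub> \<ominus>\<^bsub>R\<^esub> scalar (of_nat p) \<otimes>\<^bsub>R\<^esub> z) = \<one>\<^bsub>R\<^esub>"
proof -
  interpret R0: subring_set R0 by (rule R0_subring)
  let ?P = "scalar (of_nat p) :: nat \<Rightarrow> 'a"
  let ?a = "\<one>\<^bsub>R\<^esub> \<ominus>\<^bsub>R\<^esub> ?P \<otimes>\<^bsub>R\<^esub> z"
  define L where "L = (\<lambda>x. x \<otimes>\<^bsub>R\<^esub> ?a) ` carrier R"
  \<comment> \<open>\<open>e (i, j)\<close> is \<open>Z ^ i u ^ j\<close>; these elements generate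
    the order over \<open>R0\<close>.\<close>
  define e where "e = (\<lambda>(i, j::nat) k. if k = j then Z ^ i else 0)"
  have P: "?P \<in> carrier R" by (intro scalar_closed of_nat_mem)
  have a: "?a \<in> carrier R" using P z by simp
  have "\<one>\<^bsub>R\<^esub> \<in> L"
  proof (rule R0.nakayama[of "{..<K} \<times> {..<N}" "of_nat p" L e "carrier R"])
    show "(\<lambda>k. x k + y k) \<in> L" if xy: "x \<in> L" "y \<in> L" for x y
    proof -
      obtain x' y' where "x' \<in> carrier R" "y' \<in> carrier R" "x = x' \<otimes>\<^bsub>R\<^esub> ?a" "y = y' \<otimes>\<^bsub>R\<^esub> ?a"
        using xy by (auto simp: L_def)
      then have "(\<lambda>k. x k + y k) = (x' \<oplus>\<^bsub>R\<^esub> y') \<otimes>\<^bsub>R\<^esub> ?a" "x' \<oplus>\<^bsub>R\<^esub> y' \<in> carrier R"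
        using a l_distr[of x' y' ?a] by (auto simp: ring_ops(3)[of "x' \<otimes>\<^bsub>R\<^esub> ?a"])
      then show ?thesis by (auto simp: L_def)
    qed
    show "(\<lambda>k. b * x k) \<in> L" if b: "b \<in> R0" and x: "x \<in> L" for b x
    proof -
      obtain x' where x': "x' \<in> carrier R" "x = x' \<otimes>\<^bsub>R\<^esub> ?a"
        using x by (auto simp: L_def)
      have sb: "scalar b \<in> carrier R" using b by (intro scalar_closed R0_subset)
      have "(\<lambda>k. b * x k) = scalar b \<otimes>\<^bsub>R\<^esub> (x' \<otimes>\<^bsub>R\<^esub> ?a)"
        using x' a by (simp add: scalar_mult)
      also have "\<dots> = (scalar b \<otimes>\<^bsub>R\<^esub> x') \<otimes>\<^bsub>R\<^esub> ?a"
        using x' a sb by (simp only: m_assoc)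
      finally show ?thesis
        using x' sb by (auto simp: L_def)
    qed
    show "e i \<in> carrier R" if "i \<in> {..<K} \<times> {..<N}" for i
      using that by (auto simp: e_def carrier_iff zero_mem power_mem[OF Z_mem])
    show "\<exists>l\<in>L. \<exists>\<rho>. (\<forall>i. \<rho> i \<in> R0) \<and> x = (\<lambda>k. l k + (\<Sum>i\<in>{..<K} \<times> {..<N}. \<rho> i * e i k))"
      if x: "x \<in> carrier R" for x
    proof -
      obtain \<beta> where \<beta>: "\<And>k. (\<forall>i. \<beta> k i \<in> R0) \<and> x k = (\<Sum>i<K. \<beta> k i * Z ^ i)"
        using R0_span[OF coeff_mem[OF x]] by metis
      define \<rho> where "\<rho> = (\<lambda>(i, j). \<beta> j i)"
      have "(\<Sum>i\<in>{..<K} \<times> {..<N}. \<rho> i * e i k) = x k" for k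
      proof -
        have "(\<Sum>i\<in>{..<K} \<times> {..<N}. \<rho> i * e i k) = (\<Sum>i<K. \<Sum>j<N. if j = k then \<beta> k i * Z ^ i else 0)"
          unfolding sum.cartesian_product by (intro sum.cong) (auto simp: \<rho>_def e_def)
        also have "\<dots> = (if k < N then x k else 0)"
          using \<beta> by (simp add: sum.delta)
        finally show ?thesis
          using x by (simp add: carrier_iff)
      qed
      moreover have "(\<lambda>k. 0) \<in> L"
        using a l_null[of ?a] by (auto simp: L_def ring_ops image_iff carrier_iff zero_mem
            intro!: bexI[of _ "\<lambda>k. 0"])
      ultimately show ?thesis
        using \<beta> by (intro bexI[of _ "\<lambda>k. 0"] exI[of _ \<rho>]) (auto simp: \<rho>_def)
    qed
    show "\<exists>l\<in>L. \<exists>t\<in>carrier R. x = (\<lambda>k. l k + of_nat p * t k)" if x: "x \<in> carrier R" for x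
    proof -
      have comm: "x \<otimes>\<^bsub>R\<^esub> ?P = ?P \<otimes>\<^bsub>R\<^esub> x"
        using x by (simp add: mult_scalar scalar_mult of_nat_mem ge_fixed g_of_nat mult.commute)
      have "x \<otimes>\<^bsub>R\<^esub> (?P \<otimes>\<^bsub>R\<^esub> z) = ?P \<otimes>\<^bsub>R\<^esub> (x \<otimes>\<^bsub>R\<^esub> z)"
        using x z P comm by (simp flip: m_assoc)
      then have "x \<otimes>\<^bsub>R\<^esub> ?a = x \<ominus>\<^bsub>R\<^esub> ?P \<otimes>\<^bsub>R\<^esub> (x \<otimes>\<^bsub>R\<^esub> z)"
        using x z P by (simp add: minus_eq r_distr r_minus)
      also have "\<dots> = (\<lambda>k. x k - of_nat p * (x \<otimes>\<^bsub>R\<^esub> z) k)"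
        using x z P by (simp add: a_minus_eq) (simp add: scalar_mult)
      finally have "x = (\<lambda>k. (x \<otimes>\<^bsub>R\<^esub> ?a) k + of_nat p * (x \<otimes>\<^bsub>R\<^esub> z) k)"
        by simp
      then show ?thesis
        using x z by (auto simp: L_def)
    qed
    show "\<exists>v\<in>R0. v * (1 - of_nat p * x) = 1" if "x \<in> R0" for x
      using that by (rule R0_jacobson)
  qed (simp_all add: R0.of_nat_mem)
  then obtain w where "w \<in> carrier R" "\<one>\<^bsub>R\<^esub> = w \<otimes>\<^bsub>R\<^esub> ?a"
    unfolding L_def by blast
  then show ?thesis by (metis (no_types))
qed

lemma unit_one_minus_p:
  assumes "z \<in> carrier R"
  shows "\<one>\<^bsub>R\<^esub> \<ominus>\<^bsub>R\<^esub> scalar (of_nat p) \<otimes>\<^bsub>R\<^esub> z \<in> Units R"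
proof (rule unit_of_left_inverses)
  show "scalar (of_nat p) \<otimes>\<^bsub>R\<^esub> x = x \<otimes>\<^bsub>R\<^esub> scalar (of_nat p)" if "x \<in> carrier R" for x
    using that by (simp add: mult_scalar scalar_mult of_nat_mem ge_fixed g_of_nat mult.commute)
qed (auto intro: scalar_closed of_nat_mem left_inverse_one_minus_p assms)

section \<open>The filtration by powers of Pi\<close>

definition filt :: "nat \<Rightarrow> (nat \<Rightarrow> 'a) set" where
  "filt k = {x \<in> carrier R. \<forall>j. (pi 0 ^ k) divides x j}"

lemma filt_closed: "x \<in> filt k \<Longrightarrow> x \<in> carrier R"
  by (simp add: filt_def)

text \<open>Left multiplication by a scalar acts coefficientwise, so \<open>filt k\<close> is the
  coset that occurs in \<open>cong_mod_pow\<close>.\<close>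

lemma filt_eq: "scalar (pi 0 ^ k) <#\<^bsub>R\<^esub> carrier R = filt k"
proof (intro equalityI subsetI)
  fix x assume "x \<in> scalar (pi 0 ^ k) <#\<^bsub>R\<^esub> carrier R"
  then obtain y where y: "y \<in> carrier R" "x = scalar (pi 0 ^ k) \<otimes>\<^bsub>R\<^esub> y"
    by (auto simp: l_coset_def)
  then have "(pi 0 ^ k) divides x j" for j
    by (intro dvI[OF coeff_mem[OF y(1), of j]]) (simp add: scalar_mult)
  moreover have "x \<in> carrier R"
    unfolding y(2) by (intro m_closed scalar_closed power_mem pi_mem y(1))
  ultimately show "x \<in> filt k"
    by (simp add: filt_def)
next
  fix x assume x: "x \<in> filt k"
  then obtain y where y: "\<And>j. y j \<in> S \<and> x j = pi 0 ^ k * y j"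
    unfolding filt_def divides_def by simp metis
  define y' where "y' j = (if j < N then y j else 0)" for j
  have "y' \<in> carrier R" using y by (simp add: carrier_iff y'_def)
  moreover have "x j = pi 0 ^ k * y' j" for j
    using x y[of j] by (cases "j < N") (simp_all add: y'_def filt_def carrier_iff)
  then have "x = scalar (pi 0 ^ k) \<otimes>\<^bsub>R\<^esub> y'"
    unfolding scalar_mult[OF calculation] by blast
  ultimately show "x \<in> scalar (pi 0 ^ k) <#\<^bsub>R\<^esub> carrier R"
    by (auto simp: l_coset_def)
qed

lemma filt_diff: "x \<in> filt k \<Longrightarrow> y \<in> filt k \<Longrightarrow> x \<ominus>\<^bsub>R\<^esub> y \<in> filt k"
  using minus_closed[of x y] by (auto simp: filt_def a_minus_eq intro: dv_diff)

text \<open>By \<open>g_pi0_divides\<close> the ideals generated by powers of \<open>pi 0\<close>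
  are stable under \<open>g\<close>; this makes the filtration multiplicative.\<close>

lemma ge_divides:
  assumes "(pi 0 ^ k) divides x"
  shows "(pi 0 ^ k) divides ge i x"
proof (induction i)
  case (Suc i)
  then obtain t where t: "t \<in> S" "ge i x = pi 0 ^ k * t"
    by (auto simp: divides_def)
  then have "ge (Suc i) x = g (pi 0) ^ k * g t"
    by (simp add: g_mult g_power mem pi_mem)
  moreover have "(pi 0 ^ k) divides (g (pi 0) ^ k)"
    by (intro dv_power g_pi0_divides)
  ultimately show ?case
    using t by (auto intro: dv_mult_right g_mem)
qed (use assms in simp)

lemma filt_mult:
  assumes "x \<in> filt k" "y \<in> filt l"
  shows "x \<otimes>\<^bsub>R\<^esub> y \<in> filt (k + l)"
proof -
  have xy: "x \<in> carrier R" "y \<in> carrier R" using assms by (auto simp: filt_def)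
  have "(pi 0 ^ (k + l)) divides (x \<otimes>\<^bsub>R\<^esub> y) j" for j
  proof (cases "j < N")
    case True
    have "(pi 0 ^ l) divides ext y i" for i
      unfolding ext_def using assms by (intro dv_mult_right[OF _ c_powi_mem]) (auto simp: filt_def)
    then have "(pi 0 ^ k * pi 0 ^ l) divides (x i * ge i (ext y (int j - int i)))" for i
      using assms by (intro dv_mult ge_divides) (auto simp: filt_def)
    then show ?thesis
      using True xy by (auto simp: mult_coeff power_add intro!: dv_sum)
  qed (simp add: mult_coeff_ge dv_zero)
  then show ?thesis
    using xy by (simp add: filt_def)
qed

lemma filt_0: "filt 0 = carrier R"
  by (auto simp: filt_def intro: dvI coeff_mem)

lemma filt_pow: "x \<in> filt 1 \<Longrightarrow> x [^]\<^bsub>R\<^esub> (k::nat) \<in> filt k"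
proof (induction k)
  case (Suc k)
  then show ?case using filt_mult[of "x [^]\<^bsub>R\<^esub> k" k x 1] by simp
qed (simp add: filt_0)

text \<open>The exponent \<open>?k\<close> is such that \<open>p\<close> divides
  \<open>pi 0 ^ ?k\<close>. So \<open>1 - x ^ ?k\<close> is a unit by
  \<open>unit_one_minus_p\<close>, and \<open>unit_one_minus\<close> passes to
  \<open>1 - x\<close>.\<close>

lemma unit_one_minus_filt:
  assumes "x \<in> filt 1"
  shows "\<one>\<^bsub>R\<^esub> \<ominus>\<^bsub>R\<^esub> x \<in> Units R"
proof (rule unit_one_minus)
  let ?k = "p ^ M * (p - 1)"
  have x: "x [^]\<^bsub>R\<^esub> ?k \<in> filt ?k" using assms by (rule filt_pow)
  then have "of_nat p divides (x [^]\<^bsub>R\<^esub> ?k) j" for j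
    using p_divides_power by (auto simp: filt_def intro: dv_trans)
  then obtain y where y: "\<And>j. y j \<in> S \<and> (x [^]\<^bsub>R\<^esub> ?k) j = of_nat p * y j"
    unfolding divides_def by metis
  define y' where "y' j = (if j < N then y j else 0)" for j
  have y': "y' \<in> carrier R" using y by (simp add: carrier_iff y'_def)
  have "x [^]\<^bsub>R\<^esub> ?k = scalar (of_nat p) \<otimes>\<^bsub>R\<^esub> y'"
    unfolding scalar_mult[OF y'] using filt_closed[OF x] y by (auto simp: y'_def carrier_iff)
  then show "\<one>\<^bsub>R\<^esub> \<ominus>\<^bsub>R\<^esub> x [^]\<^bsub>R\<^esub> ?k \<in> Units R"
    using unit_one_minus_p[OF y'] by simp
qed (use assms filt_closed in auto)

text \<open>\<open>Z\<close> is 1 modulo \<open>pi 0\<close>, so replacing every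
  \<open>Z ^ i\<close> by 1 in an expansion over \<open>R0\<close> keeps the residue class.\<close>

lemma residue_lift:
  assumes "b \<in> S"
  shows "\<exists>w\<in>R0. pi 0 divides (b - w)"
proof -
  interpret R0: subring_set R0 by (rule R0_subring)
  obtain \<beta> where \<beta>: "\<And>i. \<beta> i \<in> R0" "b = (\<Sum>i<K. \<beta> i * Z ^ i)"
    using R0_span[OF assms] by blast
  have "(\<Sum>i<K. \<beta> i) - b = (\<Sum>i<K. \<beta> i * (1 - Z ^ i))"
    by (simp add: \<beta>(2) right_diff_distrib sum_subtractf)
  moreover have "pi 0 divides (\<Sum>i<K. \<beta> i * (1 - Z ^ i))"
    using one_minus_dv[OF Z_mem] \<beta>(1)
    by (intro dv_sum dv_mult_left[OF _ R0_subset]) (auto simp: pi_def)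
  ultimately have "pi 0 divides ((\<Sum>i<K. \<beta> i) - b)"
    by (simp only:)
  from dv_uminus[OF this] have "pi 0 divides (b - (\<Sum>i<K. \<beta> i))"
    by (simp only: minus_diff_eq)
  then show ?thesis
    using \<beta>(1) by (intro bexI[of _ "\<Sum>i<K. \<beta> i"] R0.sum_mem)
qed

text \<open>The coefficients of \<open>w\<close> are fixed by \<open>g\<close>, so \<open>w\<close>
  commutes with \<open>u\<close> and conjugation acts on \<open>y\<close> alone.\<close>

lemma conj_u_gen:
  assumes y: "y \<in> S" and w: "w \<in> carrier R" "\<And>k. w k \<in> R0"
  shows "u_gen \<otimes>\<^bsub>R\<^esub> (\<one>\<^bsub>R\<^esub> \<ominus>\<^bsub>R\<^esub> scalar y \<otimes>\<^bsub>R\<^esub> w) \<otimes>\<^bsub>R\<^esub> inv\<^bsub>R\<^esub> u_gen = \<one>\<^bsub>R\<^esub> \<ominus>\<^bsub>R\<^esub> scalar (g y) \<otimes>\<^bsub>R\<^esub> w"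
proof -
  have sy: "scalar y \<in> carrier R" "scalar (g y) \<in> carrier R"
    using y by (auto intro: scalar_closed g_mem)
  have uw: "u_gen \<otimes>\<^bsub>R\<^esub> w = w \<otimes>\<^bsub>R\<^esub> u_gen"
    using w(2) by (intro mult_comm_fixed) (auto simp: u_gen_def g_one g_zero g_R0)
  have "u_gen \<otimes>\<^bsub>R\<^esub> (scalar y \<otimes>\<^bsub>R\<^esub> w) = scalar (g y) \<otimes>\<^bsub>R\<^esub> (u_gen \<otimes>\<^bsub>R\<^esub> w)"
    using sy w u_gen_closed y u_gen_scalar by (simp flip: m_assoc)
  then have "u_gen \<otimes>\<^bsub>R\<^esub> (scalar y \<otimes>\<^bsub>R\<^esub> w) = (scalar (g y) \<otimes>\<^bsub>R\<^esub> w) \<otimes>\<^bsub>R\<^esub> u_gen"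
    using uw sy w u_gen_closed by (simp add: m_assoc)
  then have "u_gen \<otimes>\<^bsub>R\<^esub> (\<one>\<^bsub>R\<^esub> \<ominus>\<^bsub>R\<^esub> scalar y \<otimes>\<^bsub>R\<^esub> w) = (\<one>\<^bsub>R\<^esub> \<ominus>\<^bsub>R\<^esub> scalar (g y) \<otimes>\<^bsub>R\<^esub> w) \<otimes>\<^bsub>R\<^esub> u_gen"
    using sy w u_gen_closed by (simp add: minus_eq r_distr r_minus l_distr l_minus)
  then show ?thesis
    using sy w u_gen_closed u_gen_Units by (simp add: m_assoc)
qed

text \<open>For \<open>a = y w\<close>, \<open>a' = g(y) w\<close> and \<open>v\<close> the inverse
  of \<open>1 - a\<close>, one has \<open>v = 1 + a v\<close>, and the commutator is
  \<open>(1 - a') v = 1 + f + f a v\<close> with \<open>f = a - a'\<close>. As \<open>f\<close> lies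
  in \<open>filt n\<close> and \<open>a\<close> in \<open>filt 1\<close>, the last term is
  negligible; \<open>f\<close> matches \<open>d - 1\<close> by hypothesis.\<close>

lemma commutator_cong:
  assumes y: "y \<in> S" "pi 0 divides y" and w: "w \<in> carrier R" "\<And>k. w k \<in> R0"
    and d: "d \<in> carrier R"
    and n: "\<And>k. (pi 0 ^ Suc n) divides ((d \<ominus>\<^bsub>R\<^esub> \<one>\<^bsub>R\<^esub>) k - (y - g y) * w k)"
      "(pi 0 ^ n) divides (y - g y)"
  shows "d \<ominus>\<^bsub>R\<^esub> commutator R u_gen (\<one>\<^bsub>R\<^esub> \<ominus>\<^bsub>R\<^esub> scalar y \<otimes>\<^bsub>R\<^esub> w) \<in> filt (Suc n)"
proof -
  define a a' f v e where "a = scalar y \<otimes>\<^bsub>R\<^esub> w" and "a' = scalar (g y) \<otimes>\<^bsub>R\<^esub> w"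
    and "f = scalar (y - g y) \<otimes>\<^bsub>R\<^esub> w" and "v = inv\<^bsub>R\<^esub> (\<one>\<^bsub>R\<^esub> \<ominus>\<^bsub>R\<^esub> a)" and "e = d \<ominus>\<^bsub>R\<^esub> \<one>\<^bsub>R\<^esub>"
  have sc: "scalar y \<in> carrier R" "scalar (g y) \<in> carrier R" "scalar (y - g y) \<in> carrier R"
    using y by (auto intro!: scalar_closed g_mem diff_mem)
  have car: "a \<in> carrier R" "a' \<in> carrier R" "f \<in> carrier R" "e \<in> carrier R"
    using sc w d by (auto simp: a_def a'_def f_def e_def)
  have a1: "a \<in> filt 1"
    using car y(2) w by (auto simp: a_def filt_def scalar_mult intro: dv_mult_right coeff_mem)
  then have unit: "\<one>\<^bsub>R\<^esub> \<ominus>\<^bsub>R\<^esub> a \<in> Units R"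
    by (rule unit_one_minus_filt)
  then have v: "v \<in> carrier R" "(\<one>\<^bsub>R\<^esub> \<ominus>\<^bsub>R\<^esub> a) \<otimes>\<^bsub>R\<^esub> v = \<one>\<^bsub>R\<^esub>"
    by (auto simp: v_def)
  then have "v \<ominus>\<^bsub>R\<^esub> a \<otimes>\<^bsub>R\<^esub> v = \<one>\<^bsub>R\<^esub>"
    using car by (simp add: minus_eq l_distr l_minus)
  then have v_k: "v k = \<one>\<^bsub>R\<^esub> k + (a \<otimes>\<^bsub>R\<^esub> v) k" for k
    using a_minus_eq[OF v(1) m_closed[OF car(1) v(1)]] by (simp add: fun_eq_iff diff_eq_eq)
  then have v_eq: "v = \<one>\<^bsub>R\<^esub> \<oplus>\<^bsub>R\<^esub> a \<otimes>\<^bsub>R\<^esub> v"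
    by (auto simp: ring_ops(3))
  have f_eq: "a \<ominus>\<^bsub>R\<^esub> a' = f"
    using car w by (auto simp: a_minus_eq) (auto simp: a_def a'_def f_def scalar_mult left_diff_distrib)
  have fv: "f \<otimes>\<^bsub>R\<^esub> v = f \<oplus>\<^bsub>R\<^esub> f \<otimes>\<^bsub>R\<^esub> (a \<otimes>\<^bsub>R\<^esub> v)"
    by (subst v_eq) (use car v in \<open>simp add: r_distr\<close>)
  have f_filt: "f \<in> filt n"
    using car n(2) w by (auto simp: f_def filt_def scalar_mult intro: dv_mult_right coeff_mem)
  have "commutator R u_gen (\<one>\<^bsub>R\<^esub> \<ominus>\<^bsub>R\<^esub> scalar y \<otimes>\<^bsub>R\<^esub> w) = (\<one>\<^bsub>R\<^esub> \<ominus>\<^bsub>R\<^esub> a') \<otimes>\<^bsub>R\<^esub> v"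
    unfolding commutator_def conj_u_gen[OF y(1) w] by (simp add: a_def a'_def v_def)
  also have "\<dots> = v \<ominus>\<^bsub>R\<^esub> a' \<otimes>\<^bsub>R\<^esub> v"
    using car v by (simp add: minus_eq l_distr l_minus)
  finally have C: "commutator R u_gen (\<one>\<^bsub>R\<^esub> \<ominus>\<^bsub>R\<^esub> scalar y \<otimes>\<^bsub>R\<^esub> w) = v \<ominus>\<^bsub>R\<^esub> a' \<otimes>\<^bsub>R\<^esub> v" .
  have "f \<otimes>\<^bsub>R\<^esub> v = a \<otimes>\<^bsub>R\<^esub> v \<ominus>\<^bsub>R\<^esub> a' \<otimes>\<^bsub>R\<^esub> v"
    unfolding f_eq[symmetric] using car v by (simp add: minus_eq l_distr l_minus)
  then have fv_k: "f k + (f \<otimes>\<^bsub>R\<^esub> (a \<otimes>\<^bsub>R\<^esub> v)) k = (a \<otimes>\<^bsub>R\<^esub> v) k - (a' \<otimes>\<^bsub>R\<^esub> v) k" for k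
    unfolding fv using car v by (simp add: a_minus_eq) (auto simp: ring_ops(3) fun_eq_iff)
  have "d \<ominus>\<^bsub>R\<^esub> (v \<ominus>\<^bsub>R\<^esub> a' \<otimes>\<^bsub>R\<^esub> v) = (e \<ominus>\<^bsub>R\<^esub> f) \<ominus>\<^bsub>R\<^esub> f \<otimes>\<^bsub>R\<^esub> (a \<otimes>\<^bsub>R\<^esub> v)"
  proof
    fix k
    have "d k - (v k - (a' \<otimes>\<^bsub>R\<^esub> v) k) = (d k - \<one>\<^bsub>R\<^esub> k - f k) - (f \<otimes>\<^bsub>R\<^esub> (a \<otimes>\<^bsub>R\<^esub> v)) k"
      using v_k[of k] fv_k[of k] by (simp add: algebra_simps)
    moreover have "e k = d k - \<one>\<^bsub>R\<^esub> k"
      using d by (simp add: e_def a_minus_coeff)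
    ultimately show "(d \<ominus>\<^bsub>R\<^esub> (v \<ominus>\<^bsub>R\<^esub> a' \<otimes>\<^bsub>R\<^esub> v)) k = ((e \<ominus>\<^bsub>R\<^esub> f) \<ominus>\<^bsub>R\<^esub> f \<otimes>\<^bsub>R\<^esub> (a \<otimes>\<^bsub>R\<^esub> v)) k"
      using car v(1) d by (simp add: a_minus_coeff)
  qed
  moreover have "e \<ominus>\<^bsub>R\<^esub> f \<in> filt (Suc n)"
  proof -
    have "f k = (y - g y) * w k" for k
      using w by (simp add: f_def scalar_mult)
    then show ?thesis
      using car n(1) minus_closed[of e f] by (simp add: filt_def a_minus_coeff flip: e_def)
  qed
  moreover have "f \<otimes>\<^bsub>R\<^esub> (a \<otimes>\<^bsub>R\<^esub> v) \<in> filt (Suc n)"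
    using filt_mult[OF f_filt filt_mult[OF a1, of v 0]] v by (simp add: filt_0)
  ultimately show ?thesis
    unfolding C by (simp only: filt_diff)
qed

theorem exists_commutator_cong:
  assumes m: "m \<ge> 1" "\<not> p dvd m" and n: "n = p ^ Suc r + p * m - 1"
    and d: "d \<in> carrier R" "d \<ominus>\<^bsub>R\<^esub> \<one>\<^bsub>R\<^esub> \<in> filt n"
  shows "\<exists>x\<in>carrier R. d \<ominus>\<^bsub>R\<^esub> commutator R u_gen
    (\<one>\<^bsub>R\<^esub> \<ominus>\<^bsub>R\<^esub> scalar (pi 0 ^ (p * m)) \<otimes>\<^bsub>R\<^esub> x) \<in> filt (n + 1)"
proof -
  have Sn: "Suc n = p ^ Suc r + p * m"
    using m p_ge_3 by (simp add: n)
  obtain y where y: "y \<in> S" "(pi 0 ^ (p * m)) divides y"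
    "(pi 0 ^ Suc n) divides (y - g y - pi 0 ^ n)"
    using exists_diff_g[OF m, folded n Sn] by blast
  obtain y' where y': "y' \<in> S" "y = pi 0 ^ (p * m) * y'"
    using y(2) by (auto simp: divides_def)
  obtain z where z: "\<And>j. z j \<in> S \<and> (d \<ominus>\<^bsub>R\<^esub> \<one>\<^bsub>R\<^esub>) j = pi 0 ^ n * z j"
    using d(2) unfolding filt_def divides_def by simp metis
  then have "\<exists>w. w \<in> R0 \<and> pi 0 divides (z j - w)" for j
    using residue_lift by blast
  \<comment> \<open>\<open>w0\<close> lifts the leading coefficients of \<open>d - 1\<close> to
    \<open>R0\<close>, where \<open>commutator_cong\<close> applies.\<close>
  then obtain w0 where w0: "\<And>j. w0 j \<in> R0 \<and> pi 0 divides (z j - w0 j)"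
    by metis
  define w where "w j = (if j < N then w0 j else 0)" for j
  have wR0: "w k \<in> R0" for k using w0 by (simp add: w_def subring_set.zero_mem[OF R0_subring])
  have w: "w \<in> carrier R"
    using R0_subset[OF wR0] by (simp add: carrier_iff) (simp add: w_def)
  have dw: "(pi 0 ^ Suc n) divides ((d \<ominus>\<^bsub>R\<^esub> \<one>\<^bsub>R\<^esub>) k - (y - g y) * w k)" for k
  proof (cases "k < N")
    case True
    have "pi 0 divides (z k - w k)"
      using w0 True by (simp add: w_def)
    with dv_refl have "(pi 0 ^ n * pi 0) divides (pi 0 ^ n * (z k - w k))"
      by (rule dv_mult)
    moreover have "(pi 0 ^ Suc n) divides ((y - g y - pi 0 ^ n) * w k)"
      using y(3) coeff_mem[OF w] by (rule dv_mult_right)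
    ultimately have "(pi 0 ^ Suc n) divides
        (pi 0 ^ n * (z k - w k) - (y - g y - pi 0 ^ n) * w k)"
      by (simp only: power_Suc2 dv_diff)
    moreover have "(d \<ominus>\<^bsub>R\<^esub> \<one>\<^bsub>R\<^esub>) k - (y - g y) * w k =
        pi 0 ^ n * (z k - w k) - (y - g y - pi 0 ^ n) * w k"
      using z[of k] by (simp add: right_diff_distrib left_diff_distrib)
    ultimately show ?thesis by (simp only:)
  next
    case False
    then have "(d \<ominus>\<^bsub>R\<^esub> \<one>\<^bsub>R\<^esub>) k = 0"
      using filt_closed[OF d(2)] carrier_iff[of "d \<ominus>\<^bsub>R\<^esub> \<one>\<^bsub>R\<^esub>"] by (simp only: not_less)
    then show ?thesis using False by (simp add: w_def dv_zero)
  qed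
  have yn: "(pi 0 ^ n) divides (y - g y)"
  proof -
    have "(pi 0 ^ n) divides (y - g y - pi 0 ^ n)"
      using y(3) by (rule dv_power_mono[OF pi_mem, rotated]) simp
    from dv_add[OF this dv_refl] show ?thesis by simp
  qed
  have "(pi 0 ^ 1) divides y"
    using y(2) m p_ge_3 by (intro dv_power_mono[OF pi_mem, of 1 "p * m"]) auto
  then have "d \<ominus>\<^bsub>R\<^esub> commutator R u_gen (\<one>\<^bsub>R\<^esub> \<ominus>\<^bsub>R\<^esub> scalar y \<otimes>\<^bsub>R\<^esub> w) \<in> filt (Suc n)"
    by (intro commutator_cong y(1) w wR0 d(1) dw yn) simp
  moreover have "scalar y \<otimes>\<^bsub>R\<^esub> w = scalar (pi 0 ^ (p * m)) \<otimes>\<^bsub>R\<^esub> (scalar y' \<otimes>\<^bsub>R\<^esub> w)"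
    using w y' by (simp add: scalar_closed mem pi_mem scalar_scalar flip: m_assoc)
  ultimately show ?thesis
    using w y' by (intro bexI[of _ "scalar y' \<otimes>\<^bsub>R\<^esub> w"]) (simp_all add: scalar_closed)
qed

end

section \<open>Power series over the ring of integers\<close>

lemma p_mult_dvd_power_diff_one:
  fixes u :: int
  assumes "int p dvd u"
  shows "int p * u dvd (1 + u) ^ p - 1"
proof -
  have "u dvd (1 + u) ^ i - 1" for i
    using power_diff_1_eq[of "1 + u" i] by simp
  then have "int p dvd (\<Sum>i<p. (1 + u) ^ i - 1)"
    using assms by (intro dvd_sum) (blast intro: dvd_trans)
  then have "int p dvd (\<Sum>i<p. (1 + u) ^ i) - int p"
    by (simp add: sum_subtractf)
  then have "int p dvd (\<Sum>i<p. (1 + u) ^ i)"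
    by (metis dvd_refl dvd_diff_commute dvd_add diff_add_cancel)
  then have "int p * u dvd u * (\<Sum>i<p. (1 + u) ^ i)"
    by (metis mult.commute mult_dvd_mono dvd_refl)
  then show ?thesis
    using power_diff_1_eq[of "1 + u" p] by simp
qed

lemma one_plus_prime_power_cong:
  assumes "r \<ge> 1"
  shows "int (p ^ (r + s)) dvd int ((1 + p ^ r) ^ (p ^ s)) - 1"
proof (induction s)
  case (Suc s)
  define u where "u = int ((1 + p ^ r) ^ (p ^ s)) - 1"
  have "int p dvd int (p ^ (r + s))"
    using assms by simp
  then have "int p dvd u"
    using Suc dvd_trans unfolding u_def by blast
  then have "int p * u dvd (1 + u) ^ p - 1"
    by (rule p_mult_dvd_power_diff_one)
  moreover have "int (p ^ (r + Suc s)) dvd int p * u"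
    using Suc by (simp add: u_def)
  moreover have "(1 + u) ^ p = int ((1 + p ^ r) ^ (p ^ Suc s))"
    by (simp add: u_def mult.commute flip: power_mult)
  ultimately show ?case
    using dvd_trans by metis
qed simp

text \<open>The \<open>k\<close>-th iterate of \<open>g\<close> raises \<open>Z\<close> to the power
  \<open>(1 + p ^ r) ^ k\<close>, and for \<open>k = p ^ s\<close> this exponent is 1 modulo
  \<open>p ^ (r + s)\<close>.\<close>

lemma (in subring_hom) funpow_fixes_span:
  assumes Z: "Z \<in> S" "Z ^ (p ^ (r + s)) = 1" "g Z = Z ^ (1 + p ^ r)" and "r \<ge> 1" "p \<ge> 1"
    and \<beta>: "\<And>i. \<beta> i \<in> S" "\<And>i. g (\<beta> i) = \<beta> i"
  shows "(g ^^ (p ^ s)) (\<Sum>i<K. \<beta> i * Z ^ i) = (\<Sum>i<K. \<beta> i * Z ^ i)"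
proof -
  have iter: "(g ^^ k) (\<Sum>i<K. \<beta> i * Z ^ i) = (\<Sum>i<K. \<beta> i * (Z ^ ((1 + p ^ r) ^ k)) ^ i)" for k
  proof (induction k)
    case (Suc k)
    have "g (\<Sum>i<K. \<beta> i * (Z ^ ((1 + p ^ r) ^ k)) ^ i) =
        (\<Sum>i<K. \<beta> i * ((Z ^ (1 + p ^ r)) ^ ((1 + p ^ r) ^ k)) ^ i)"
      using Z \<beta> by (subst g_sum) (auto simp: g_mult g_power mem)
    then show ?case
      using Suc by (simp only: funpow.simps comp_def flip: power_mult) (simp add: mult.assoc)
  qed simp
  let ?e = "(1 + p ^ r) ^ (p ^ s)"
  have "?e \<ge> 1" by simp
  then have "int ?e - 1 = int (?e - 1)"
    by (simp only: of_nat_diff of_nat_1)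
  then have "p ^ (r + s) dvd ?e - 1"
    using one_plus_prime_power_cong[OF assms(4), of p s] by (simp only: int_dvd_int_iff)
  then obtain t where "?e - 1 = p ^ (r + s) * t" by blast
  then have "?e = p ^ (r + s) * t + 1"
    using \<open>?e \<ge> 1\<close> by linarith
  then have "Z ^ ?e = (Z ^ p ^ (r + s)) ^ t * Z"
    by (simp only: power_add power_mult power_one_right)
  then have "Z ^ ?e = Z"
    using Z(2) by simp
  then show ?thesis
    unfolding iter by (simp only:)
qed

section \<open>Adjoining a root of unity, and power series over a subring\<close>

lemma subring_adjoin:
  assumes "subring_set R"
  shows "subring_set (adjoin R z)"
proof
  interpret subring_set R by fact
  show "1 \<in> adjoin R z"
    by (auto simp: adjoin_def one_mem zero_mem intro!: exI[of _ 1])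
  fix x y assume "x \<in> adjoin R z" "y \<in> adjoin R z"
  then obtain q q' where q: "x = poly q z" "y = poly q' z" "\<And>i. coeff q i \<in> R" "\<And>i. coeff q' i \<in> R"
    by (auto simp: adjoin_def)
  show "x - y \<in> adjoin R z"
    unfolding adjoin_def using q by (auto intro!: exI[of _ "q - q'"] diff_mem)
  show "x * y \<in> adjoin R z"
    unfolding adjoin_def using q by (auto simp: coeff_mult intro!: exI[of _ "q * q'"] mult_mem sum_mem)
qed

lemma adjoin_contains: "subring_set R \<Longrightarrow> x \<in> R \<Longrightarrow> x \<in> adjoin R z"
  using subring_set.zero_mem
  by (auto simp: adjoin_def coeff_pCons split: nat.split intro!: exI[of _ "[:x:]"])

lemma adjoin_generator: "subring_set R \<Longrightarrow> z \<in> adjoin R z"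
  using subring_set.zero_mem subring_set.one_mem
  by (auto simp: adjoin_def coeff_pCons split: nat.split intro!: exI[of _ "[:0, 1:]"])

text \<open>Exponents are reduced modulo \<open>K\<close> by grouping the coefficients of a
  representing polynomial by residue class.\<close>

lemma adjoin_root_of_unity_span:
  assumes "subring_set R" "z ^ K = 1" "K > 0" "x \<in> adjoin R z"
  shows "\<exists>c. (\<forall>i. c i \<in> R) \<and> x = (\<Sum>i<K. c i * z ^ i)"
proof -
  interpret subring_set R by fact
  obtain q where q: "x = poly q z" "\<And>i. coeff q i \<in> R"
    using assms(4) by (auto simp: adjoin_def)
  define c where "c j = (\<Sum>i\<in>{i \<in> {..degree q}. i mod K = j}. coeff q i)" for j
  have z_mod: "z ^ (i mod K) = z ^ i" for i
  proof -
    have "z ^ i = z ^ (K * (i div K) + i mod K)" by simp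
    also have "\<dots> = (z ^ K) ^ (i div K) * z ^ (i mod K)"
      by (simp only: power_add power_mult)
    finally show ?thesis by (simp add: assms(2))
  qed
  have "(\<Sum>j<K. c j * z ^ j) = (\<Sum>j<K. \<Sum>i\<in>{i \<in> {..degree q}. i mod K = j}. coeff q i * z ^ i)"
    unfolding c_def sum_distrib_right by (intro sum.cong refl) (auto simp: z_mod)
  also have "\<dots> = (\<Sum>i\<le>degree q. coeff q i * z ^ i)"
    using assms(3) by (intro sum.group) auto
  finally show ?thesis
    using q by (intro exI[of _ c]) (auto simp: c_def poly_altdef intro: sum_mem)
qed

lemma subring_power_series_ring:
  assumes "subring_set R"
  shows "subring_set (power_series_ring R)"
proof
  interpret subring_set R by fact
  show "1 \<in> power_series_ring R"
    by (auto simp: power_series_ring_def zero_mem one_mem intro!: image_eqI[of _ _ 1])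
  fix x y assume "x \<in> power_series_ring R" "y \<in> power_series_ring R"
  then obtain f h where fh: "x = fps_to_fls f" "y = fps_to_fls h" "\<And>i. fps_nth f i \<in> R" "\<And>i. fps_nth h i \<in> R"
    by (auto simp: power_series_ring_def)
  show "x - y \<in> power_series_ring R"
    using fh by (auto simp: power_series_ring_def intro!: image_eqI[of _ _ "f - h"] diff_mem)
  show "x * y \<in> power_series_ring R"
    using fh by (auto simp: power_series_ring_def fps_mult_nth fls_times_fps_to_fls
        intro!: image_eqI[of _ _ "f * h"] sum_mem mult_mem)
qed

lemma power_series_ring_const:
  "subring_set R \<Longrightarrow> a \<in> R \<Longrightarrow> fls_const a \<in> power_series_ring R"
  using subring_set.zero_mem
  by (auto simp: power_series_ring_def intro!: image_eqI[of _ _ "fps_const a"])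

lemma power_series_ring_mono: "R \<subseteq> R' \<Longrightarrow> power_series_ring R \<subseteq> power_series_ring R'"
  by (auto simp: power_series_ring_def)

text \<open>The recursion for the coefficients of the inverse divides only by the constant
  term.\<close>

lemma power_series_ring_inverse:
  assumes "subring_set R" "\<And>i. fps_nth f i \<in> R" "inverse (fps_nth f 0) \<in> R" "fps_nth f 0 \<noteq> 0"
  shows "inverse (fps_to_fls f) \<in> power_series_ring R" "fps_to_fls f \<noteq> 0"
proof -
  interpret subring_set R by fact
  have "fps_nth (inverse f) n \<in> R" for n
  proof (induction n rule: less_induct)
    case (less n)
    show ?case
    proof (cases n)
      case (Suc k)
      have "(\<Sum>i=1..n. fps_nth f i * fps_nth (inverse f) (n - i)) \<in> R"
        using less assms(2) Suc by (intro sum_mem mult_mem) auto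
      then show ?thesis
        using Suc assms(3) by (simp add: fps_inverse_def uminus_mem mult_mem del: sum.cl_ivl_Suc)
    qed (use assms(3) in simp)
  qed
  moreover have "fps_to_fls (inverse f) * fps_to_fls f = 1"
    using inverse_mult_eq_1[OF assms(4)] by (simp flip: fls_times_fps_to_fls)
  then have "inverse (fps_to_fls f) = fps_to_fls (inverse f)"
    by (metis inverse_unique mult.commute)
  ultimately show "inverse (fps_to_fls f) \<in> power_series_ring R"
    by (auto simp: power_series_ring_def)
  show "fps_to_fls f \<noteq> 0" using assms(4) by auto
qed

lemma fps_to_fls_sum: "fps_to_fls (sum f I) = (\<Sum>i\<in>I. fps_to_fls (f i))"
  by (induction I rule: infinite_finite_induct) auto

text \<open>The number \<open>K\<close> of terms is the same for every coefficient, so the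
  coefficientwise expansions assemble into \<open>K\<close> power series.\<close>

lemma power_series_ring_adjoin_span:
  assumes R: "subring_set R" and z: "z ^ K = 1" "K > 0" and x: "x \<in> power_series_ring (adjoin R z)"
  shows "\<exists>\<beta>. (\<forall>i. \<beta> i \<in> power_series_ring R) \<and> x = (\<Sum>i<K. \<beta> i * fls_const z ^ i)"
proof -
  obtain f where f: "x = fps_to_fls f" "\<And>n. fps_nth f n \<in> adjoin R z"
    using x by (auto simp: power_series_ring_def)
  obtain c where c: "\<And>n. (\<forall>i. c n i \<in> R) \<and> fps_nth f n = (\<Sum>i<K. c n i * z ^ i)"
    using adjoin_root_of_unity_span[OF R z f(2)] by metis
  have "f = (\<Sum>i<K. Abs_fps (\<lambda>n. c n i) * fps_const (z ^ i))"
    using c by (intro fps_ext) (simp add: fps_sum_nth)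
  then have "x = (\<Sum>i<K. fps_to_fls (Abs_fps (\<lambda>n. c n i)) * fls_const z ^ i)"
    unfolding f(1) by (simp add: fps_to_fls_sum fls_times_fps_to_fls fls_const_power)
  moreover have "fps_to_fls (Abs_fps (\<lambda>n. c n i)) \<in> power_series_ring R" for i
    using c by (auto simp: power_series_ring_def)
  ultimately show ?thesis
    by (intro exI[of _ "\<lambda>i. fps_to_fls (Abs_fps (\<lambda>n. c n i))"]) auto
qed

lemma subset_fraction_field: "1 \<in> R \<Longrightarrow> R \<subseteq> fraction_field R"
  by (force simp: fraction_field_def)

section \<open>Absolute values and the ring of integers\<close>

lemma nonarch_abs_one:
  assumes "is_subfield K" "nonarch_abs_on nrm K"
  shows "nrm 1 = 1"
proof -
  have "nrm 1 * nrm 1 = nrm (1 * 1)" "nrm 1 \<noteq> 0"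
    using assms unfolding is_subfield_def nonarch_abs_on_def by (metis, metis zero_neq_one)
  then show ?thesis by simp
qed

lemma subring_ring_of_integers:
  assumes K: "is_subfield K" and nrm: "nonarch_abs_on nrm K"
  shows "subring_set (ring_of_integers nrm K)"
proof
  have K_mem: "1 \<in> K" "0 \<in> K" "\<And>x y. x \<in> K \<Longrightarrow> y \<in> K \<Longrightarrow> x - y \<in> K \<and> x * y \<in> K"
    using K by (auto simp: is_subfield_def)
  have K_uminus: "- x \<in> K" if "x \<in> K" for x
    using K_mem(3)[OF K_mem(2) that] by simp
  have mult: "nrm (x * y) = nrm x * nrm y" and add: "nrm (x + y) \<le> max (nrm x) (nrm y)"
    and nonneg: "0 \<le> nrm x" if "x \<in> K" "y \<in> K" for x y
    using nrm that by (auto simp: nonarch_abs_on_def)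
  have "nrm (- 1) * nrm (- 1) = nrm 1"
    using mult[of "- 1" "- 1"] K_uminus K_mem by simp
  then have "nrm (- 1) = 1 \<or> nrm (- 1) = - 1"
    using nonarch_abs_one[OF K nrm] by (simp add: power2_eq_1_iff flip: power2_eq_square)
  then have m1: "nrm (- 1) = 1"
    using nonneg[of "- 1" 1] K_uminus K_mem by auto
  show "1 \<in> ring_of_integers nrm K"
    using nonarch_abs_one[OF K nrm] K_mem by (simp add: ring_of_integers_def)
  fix x y assume xy: "x \<in> ring_of_integers nrm K" "y \<in> ring_of_integers nrm K"
  then have xyK: "x \<in> K" "y \<in> K" and le: "nrm x \<le> 1" "nrm y \<le> 1"
    by (auto simp: ring_of_integers_def)
  have "nrm (- y) = nrm y"
    using mult[of "- 1" y] m1 K_uminus K_mem xyK by simp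
  then have "nrm (x - y) \<le> 1"
    using add[of x "- y"] K_uminus xyK le by simp
  then show "x - y \<in> ring_of_integers nrm K"
    using K_mem xyK by (simp add: ring_of_integers_def)
  have "nrm x * nrm y \<le> 1"
    using le nonneg xyK by (simp add: mult_le_one)
  then show "x * y \<in> ring_of_integers nrm K"
    using K_mem xyK mult by (simp add: ring_of_integers_def)
qed

text \<open>The ultrametric inequality for \<open>1 = (1 - p x) + p x\<close> with
  \<open>p x\<close> of absolute value below 1 forces that of \<open>1 - p x\<close> to be at least
  1. Here \<open>p\<close> is any integral element of absolute value below 1.\<close>

lemma ring_of_integers_one_minus_unit:
  assumes K: "is_subfield K" and nrm: "nonarch_abs_on nrm K"
    and p: "p \<in> ring_of_integers nrm K" "nrm p < 1" and x: "x \<in> ring_of_integers nrm K"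
  shows "inverse (1 - p * x) \<in> ring_of_integers nrm K" "1 - p * x \<noteq> 0"
proof -
  have K_mem: "1 \<in> K" "0 \<in> K" "\<And>x y. x \<in> K \<Longrightarrow> y \<in> K \<Longrightarrow> x - y \<in> K \<and> x * y \<in> K"
    "\<And>x. x \<in> K \<Longrightarrow> inverse x \<in> K"
    using K by (auto simp: is_subfield_def)
  have mult: "nrm (x * y) = nrm x * nrm y" and add: "nrm (x + y) \<le> max (nrm x) (nrm y)"
    and nonneg: "0 \<le> nrm x" and zero: "nrm x = 0 \<longleftrightarrow> x = 0" if "x \<in> K" "y \<in> K" for x y
    using nrm that by (auto simp: nonarch_abs_on_def)
  have px: "p \<in> K" "x \<in> K" "nrm x \<le> 1"
    using p x by (auto simp: ring_of_integers_def)
  have "nrm p * nrm x \<le> nrm p"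
    using px nonneg[of p p] by (simp add: mult_left_le)
  then have "nrm (p * x) < 1"
    using p(2) mult px by simp
  moreover have "1 \<le> max (nrm (1 - p * x)) (nrm (p * x))"
    using add[of "1 - p * x" "p * x"] K_mem px nonarch_abs_one[OF K nrm] by simp
  ultimately have ge: "1 \<le> nrm (1 - p * x)" by linarith
  have mem: "1 - p * x \<in> K" using K_mem px by simp
  show nz: "1 - p * x \<noteq> 0"
    using ge zero[OF K_mem(2) K_mem(2)] by force
  have "nrm (1 - p * x) * nrm (inverse (1 - p * x)) = 1"
    using mult[of "1 - p * x" "inverse (1 - p * x)"] mem K_mem nz nonarch_abs_one[OF K nrm] by simp
  then have "nrm (inverse (1 - p * x)) = inverse (nrm (1 - p * x))"
    by (metis inverse_unique)
  then show "inverse (1 - p * x) \<in> ring_of_integers nrm K"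
    using ge mem K_mem by (simp add: ring_of_integers_def inverse_le_1_iff)
qed

lemma padic_abs_prime:
  assumes "prime p"
  shows "padic_abs p (of_nat p) = 1 / real p"
proof -
  have "quotient_of (of_nat p) = (int p, 1)"
    using quotient_of_int[of "int p"] by simp
  moreover have "multiplicity (int p) (int p) = 1"
    using assms by (intro multiplicity_self) (auto simp: prime_gt_0_nat dest: prime_gt_1_nat)
  ultimately show ?thesis
    using assms prime_gt_0_nat[of p] by (simp add: padic_abs_def power_int_minus divide_inverse)
qed

section \<open>Specialisation to the order Delta\<close>

lemma \<Delta>_eq_cyclic_algebra:
  assumes "1 \<in> B_ring r s nrm F \<zeta>"
  shows "\<Delta> p r s nrm F \<zeta> g = cyclic_algebra (p ^ s) g (1 + fls_X) (B_ring r s nrm F \<zeta>)"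
  using subset_fraction_field[OF assms]
  by (auto simp: \<Delta>_def D_alg_def cyclic_algebra_def)

theorem mainTheorem9:
  fixes p r s m n :: nat
    and nrm :: "'k::field_char_0 \<Rightarrow> real"
    and Qp F :: "'k set"
    and \<zeta> :: "nat \<Rightarrow> 'k"
    and g :: "'k fls \<Rightarrow> 'k fls"
    and d :: "nat \<Rightarrow> 'k fls"
  assumes "prime p" and "odd p" and "r \<ge> 1" and "s \<ge> 3"
    and "is_padic_field p nrm Qp"
    and "finite_unramified_extension nrm Qp F"
    and "\<zeta> 0 = 1"
    and "\<And>i. \<zeta> (Suc i) ^ p = \<zeta> i"
    and "\<And>i. primitive_root_of_unity (p ^ i) (\<zeta> i)"
    and "g \<in> galois_group (fraction_field (B_ring r s nrm F \<zeta>)) (fraction_field (A_ring r nrm F \<zeta>))"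
    and "g (fls_const (\<zeta> (r + s))) = fls_const (\<zeta> (r + s) ^ (1 + p ^ r))"
    and "d \<in> Units (\<Delta> p r s nrm F \<zeta> g)"
    and "has_level (\<Delta> p r s nrm F \<zeta> g) (Pi_B r s \<zeta>) d n"
    and "has_type p r n 1 m"
  shows "\<exists>x \<in> carrier (\<Delta> p r s nrm F \<zeta> g).
    cong_mod_pow (\<Delta> p r s nrm F \<zeta> g) (Pi_B r s \<zeta>) (n + 1) d
      (commutator (\<Delta> p r s nrm F \<zeta> g) u_gen
        (\<one>\<^bsub>\<Delta> p r s nrm F \<zeta> g\<^esub> \<ominus>\<^bsub>\<Delta> p r s nrm F \<zeta> g\<^esub>
          (Pi_B r s \<zeta> [^]\<^bsub>\<Delta> p r s nrm F \<zeta> g\<^esub> (p * m)) \<otimes>\<^bsub>\<Delta> p r s nrm F \<zeta> g\<^esub> x))"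
proof -
  let ?O = "ring_of_integers nrm F" and ?z = "\<zeta> (r + s)"
  define A B R0 where "A = A_ring r nrm F \<zeta>" and "B = B_ring r s nrm F \<zeta>"
    and "R0 = power_series_ring ?O"
  note p = \<open>prime p\<close> and root = \<open>\<And>i. primitive_root_of_unity (p ^ i) (\<zeta> i)\<close>
  have F: "is_subfield F" "nonarch_abs_on nrm F" "Qp \<subseteq> F"
    using \<open>finite_unramified_extension nrm Qp F\<close>
    by (auto simp: finite_unramified_extension_def finite_extension_def)
  have O: "subring_set ?O"
    using F by (intro subring_ring_of_integers)
  interpret O: subring_set ?O by (rule O)
  have OB: "subring_set (adjoin ?O ?z)" and OA: "subring_set (adjoin ?O (\<zeta> r))"
    using O by (auto intro: subring_adjoin)
  have A_sub: "subring_set A" and B_sub: "subring_set B" and R0_sub: "subring_set R0"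
    unfolding A_def B_def R0_def A_ring_def B_ring_def \<OO>_def
    using O OA OB by (auto intro: subring_power_series_ring)
  interpret B: subring_set B by (rule B_sub)
  have R0A: "R0 \<subseteq> A" and R0B: "R0 \<subseteq> B"
    unfolding A_def B_def R0_def A_ring_def B_ring_def \<OO>_def
    using O by (auto intro!: power_series_ring_mono adjoin_contains)
  have zK: "?z ^ (p ^ (r + s)) = 1" and K0: "p ^ (r + s) > 0"
    using root[of "r + s"] p by (auto simp: primitive_root_of_unity_def prime_gt_0_nat)
  have span: "\<exists>\<beta>. (\<forall>i. \<beta> i \<in> R0) \<and> b = (\<Sum>i<p ^ (r + s). \<beta> i * fls_const ?z ^ i)" if "b \<in> B" for b
    using that unfolding R0_def B_def B_ring_def \<OO>_def
    by (intro power_series_ring_adjoin_span O zK K0)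
  have Z_mem: "fls_const ?z \<in> B"
    unfolding B_def B_ring_def \<OO>_def
    by (intro power_series_ring_const OB adjoin_generator O)
  have ZK: "fls_const ?z ^ (p ^ (r + s)) = 1"
    using zK by (simp flip: fls_const_power)
  have gal: "g (x + y) = g x + g y \<and> g (x * y) = g x * g y" if "x \<in> B" "y \<in> B" for x y
    using \<open>g \<in> galois_group _ _\<close> that subset_fraction_field[of B] B.one_mem
    unfolding galois_group_def B_def by blast
  have g_A: "g x = x" if "x \<in> A" for x
    using \<open>g \<in> galois_group _ _\<close> that subset_fraction_field[of A] subring_set.one_mem[OF A_sub]
    unfolding galois_group_def A_def by blast
  have g_Z: "g (fls_const ?z) = fls_const ?z ^ (1 + p ^ r)"
    using assms(11) by (simp only: fls_const_power)
  have g_one: "g 1 = 1"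
    using g_A subring_set.one_mem[OF A_sub] by blast
  have g_zero: "g 0 = 0"
    using g_A subring_set.zero_mem[OF A_sub] by blast
  have g_pow: "g (x ^ k) = g x ^ k" if "x \<in> B" for x k
    by (induction k) (use that gal g_one B.power_mem in auto)
  have g_sum: "g (sum f I) = (\<Sum>i\<in>I. g (f i))" if "\<And>i. i \<in> I \<Longrightarrow> f i \<in> B" for f and I :: "nat set"
    using that by (induction I rule: infinite_finite_induct) (auto simp: g_zero gal B.sum_mem)
  \<comment> \<open>The Galois condition speaks of the fraction field; stability of \<open>B\<close>
    itself comes from the expansion over \<open>R0\<close>, which \<open>g\<close> fixes, and from
    \<open>g_Z\<close>.\<close>
  have g_mem: "g b \<in> B" if b: "b \<in> B" for b
  proof -
    obtain \<beta> where \<beta>: "\<And>i. \<beta> i \<in> R0" "b = (\<Sum>i<p ^ (r + s). \<beta> i * fls_const ?z ^ i)"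
      using span[OF b] by blast
    have "g b = (\<Sum>i<p ^ (r + s). \<beta> i * (fls_const ?z ^ (1 + p ^ r)) ^ i)"
      unfolding \<beta>(2) using \<beta>(1) R0A R0B Z_mem
      by (subst g_sum) (auto intro!: B.mult_mem B.power_mem sum.cong simp: gal g_pow B.power_mem g_Z g_A subsetD)
    then show ?thesis
      using \<beta>(1) R0B Z_mem by (auto intro!: B.sum_mem B.mult_mem B.power_mem)
  qed
  interpret hom: subring_hom B g
    by unfold_locales (auto simp: g_mem g_one gal)
  have pO: "of_nat p \<in> ?O" by (rule O.of_nat_mem)
  have "nrm (of_rat (of_nat p)) = padic_abs p (of_nat p)"
    using \<open>is_padic_field p nrm Qp\<close> by (simp only: is_padic_field_def)
  then have p_small: "nrm (of_nat p) < 1"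
    using padic_abs_prime[OF p] prime_gt_1_nat[OF p] by simp
  \<comment> \<open>The constant term of \<open>1 - p x\<close> is a unit of the ring of integers
    because \<open>p\<close> has absolute value below 1, and that suffices for a power
    series.\<close>
  have jacobson: "\<exists>v\<in>R0. v * (1 - of_nat p * x) = 1" if x: "x \<in> R0" for x
  proof -
    obtain f where f: "x = fps_to_fls f" "\<And>n. fps_nth f n \<in> ?O"
      using x by (auto simp: R0_def power_series_ring_def)
    let ?h = "1 - of_nat p * f"
    have h: "fps_to_fls ?h = 1 - of_nat p * x"
      by (simp add: f fls_times_fps_to_fls fps_to_fls_of_nat)
    have h_nth: "fps_nth ?h n = (if n = 0 then 1 else 0) - of_nat p * fps_nth f n" for n
      by (simp flip: fps_of_nat)
    have h_O: "fps_nth ?h n \<in> ?O" for n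
      unfolding h_nth using f(2) by (intro O.mem) (simp add: O.mem)
    have "inverse (fps_nth ?h 0) \<in> ?O" "fps_nth ?h 0 \<noteq> 0"
      unfolding h_nth using ring_of_integers_one_minus_unit[OF F(1,2) pO p_small f(2)[of 0]] by simp_all
    from power_series_ring_inverse[OF O h_O this]
    have "inverse (fps_to_fls ?h) \<in> R0" "fps_to_fls ?h \<noteq> 0"
      by (simp_all only: R0_def not_False_eq_True)
    then show ?thesis
      unfolding h by (intro bexI[of _ "inverse (1 - of_nat p * x)"]) auto
  qed
  define c where "c = (1 + fls_X :: 'k fls)"
  have c_fps: "c = fps_to_fls (1 + fps_X)"
    by (simp add: c_def)
  have c_nth: "fps_nth (1 + fps_X) n \<in> ?O" for n
    using O.one_mem O.zero_mem by (auto simp: fps_X_nth)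
  then have cR0: "c \<in> R0"
    unfolding c_fps R0_def power_series_ring_def by blast
  have c_inv: "inverse c \<in> R0" "c \<noteq> 0"
    unfolding c_fps R0_def using power_series_ring_inverse[OF O c_nth] O.one_mem by simp_all
  \<comment> \<open>Chosen so that \<open>?z\<close> has order \<open>p ^ Suc M\<close>; then
    \<open>s \<ge> 3\<close> becomes \<open>r + 2 \<le> M\<close>.\<close>
  define M where "M = r + s - 1"
  have M: "Suc M = r + s" "r + 2 \<le> M" using \<open>s \<ge> 3\<close> by (auto simp: M_def)
  have Z_order: "fls_const ?z ^ (p ^ M) \<noteq> 1"
  proof -
    have "p ^ M < p ^ (r + s)" "0 < p ^ M"
      using M(1) prime_gt_1_nat[OF p] by (auto intro: power_strict_increasing)
    then have "?z ^ (p ^ M) \<noteq> 1"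
      using root[of "r + s"] by (auto simp: primitive_root_of_unity_def)
    then show ?thesis by (simp flip: fls_const_power)
  qed
  have N: "p ^ s > 1"
    using \<open>s \<ge> 3\<close> prime_gt_1_nat[OF p] by (intro one_less_power) auto
  have period: "(g ^^ (p ^ s)) x = x" if x: "x \<in> B" for x
  proof -
    obtain \<beta> where \<beta>: "\<And>i. \<beta> i \<in> R0" "x = (\<Sum>i<p ^ (r + s). \<beta> i * fls_const ?z ^ i)"
      using span[OF x] by blast
    show ?thesis
      unfolding \<beta>(2) using \<beta>(1) R0A R0B g_A \<open>r \<ge> 1\<close> prime_gt_0_nat[OF p]
      by (intro hom.funpow_fixes_span[OF Z_mem ZK g_Z]) auto
  qed
  interpret T: twisted_order B p M "fls_const ?z" g r "p ^ s" c R0 "p ^ (r + s)"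
  proof unfold_locales
    show "fls_const ?z ^ p ^ Suc M = 1" using ZK M by simp
  qed (use p \<open>odd p\<close> \<open>r \<ge> 1\<close> Z_mem Z_order g_Z M N cR0 c_inv R0B R0A g_A period R0_sub span jacobson
    in \<open>auto simp: subring_set_def\<close>)
  have \<Delta>: "\<Delta> p r s nrm F \<zeta> g = T.R"
    using \<Delta>_eq_cyclic_algebra[of r s nrm F \<zeta> p g] B.one_mem by (simp add: B_def c_def)
  have "fls_const (1 - ?z) = 1 - fls_const ?z"
    by (rule fls_eqI) simp
  then have Pi: "Pi_B r s \<zeta> = scalar (T.pi 0)"
    by (simp add: Pi_B_def T.pi_def)
  have cong_iff: "cong_mod_pow T.R (scalar (T.pi 0)) k x y \<longleftrightarrow> x \<ominus>\<^bsub>T.R\<^esub> y \<in> T.filt k" for k x y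
    by (simp add: cong_mod_pow_def T.scalar_pow T.pi_mem T.filt_eq)
  have type: "m \<ge> 1" "\<not> p dvd m" "n = p ^ Suc r + p * m - 1"
    using \<open>has_type p r n 1 m\<close> by (auto simp: has_type_def)
  have "d \<in> carrier T.R"
    using \<open>d \<in> Units _\<close> by (simp add: \<Delta> Units_def)
  moreover have "d \<ominus>\<^bsub>T.R\<^esub> \<one>\<^bsub>T.R\<^esub> \<in> T.filt n"
    using \<open>has_level _ _ d n\<close> by (simp add: has_level_def \<Delta> Pi cong_iff)
  ultimately show ?thesis
    unfolding \<Delta> Pi cong_iff T.scalar_pow[OF T.pi_mem]
    by (rule T.exists_commutator_cong[OF type])
qed

end
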